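(* There exists an absolute constant $c>0$ such that the following holds. Let $n\ge2$, let $X$ be a random vector in $\mathbb{R}^n$ with $\mathbb{E}|X|^2=n$, and let $Y$ be an independent copy of $X$. Put $$R=\frac{(|X|^2+|Y|^2)^{1/2}}{\sqrt n}\Big(1+\frac1{8n}\Big)-\frac{|X-Y|}{\sqrt n}\Big(1+\frac1{4n}\Big).$$ Then $$\Big|\,\mathbb{E}_\theta\,\omega^2(F_\theta,F)-\frac1{\sqrt{2\pi}}\,\mathbb{E}R\,\Big|\le c\,\frac{1+\sigma_4^2}{n^2}.$$
   Context: $|\cdot|$ and $\langle\cdot,\cdot\rangle$ are the Euclidean norm and inner product on $\mathbb{R}^n$. $\mathbb{E}_\theta$ denotes integration over $\theta$ in the unit sphere $\mathbb{S}^{n-1}$ with respect to the uniform probability measure $\mathfrak{s}_{n-1}$. For $\theta\in\mathbb{S}^{n-1}$, $F_\theta(x)=\mathbb{P}\{\langle X,\theta\rangle\le x\}$, and $F(x)=\mathbb{E}_\theta F_\theta(x)$ is the typical distribution function. For distribution functions $U,V$ on $\mathbb{R}$, $\omega(U,V)=\big(\int_{-\infty}^\infty (U(x)-V(x))^2dx\big)^{1/2}$. The functional $\sigma_4\ge0$ is defined by $\sigma_4^2=\frac1n\mathrm{Var}(|X|^2)$ (if it is infinite, the bound is trivial). Absolute constants do not depend on $n$ or on the distribution of $X$. *)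

theory Defs
  imports "HOL-Probability.Probability"
begin

text \<open>
  Since the constant in the theorem must not depend on the dimension \<open>n\<close>, vectors of
  \<open>\<real>\<^sup>n\<close> are functions on the index set \<open>{..<n}\<close> (not elements of a type whose dimension is
  fixed by a type parameter). \<open>Rn n\<close> is \<open>\<real>\<^sup>n\<close> with its Borel sets and Lebesgue measure.
\<close>

definition Rn :: "nat \<Rightarrow> (nat \<Rightarrow> real) measure" where
  "Rn n = (\<Pi>\<^sub>M i\<in>{..<n}. lborel)"

definition vnorm :: "nat \<Rightarrow> (nat \<Rightarrow> real) \<Rightarrow> real" where
  "vnorm n x = L2_set x {..<n}"

definition vinner :: "nat \<Rightarrow> (nat \<Rightarrow> real) \<Rightarrow> (nat \<Rightarrow> real) \<Rightarrow> real" where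
  "vinner n x y = (\<Sum>i<n. x i * y i)"

text \<open>
  The uniform probability measure on the unit sphere, as the normalised cone measure: the image
  of the uniform distribution on the unit ball under the radial projection \<open>x \<mapsto> x / |x|\<close>.
  (The origin, where the projection is meaningless, is a null set.)
\<close>

definition unif_sphere :: "nat \<Rightarrow> (nat \<Rightarrow> real) measure" where
  "unif_sphere n =
     distr (uniform_measure (Rn n) {x \<in> space (Rn n). vnorm n x \<le> 1}) (Rn n)
       (\<lambda>x. \<lambda>i\<in>{..<n}. x i / vnorm n x)"

text \<open>
  All quantities below depend on the random vector \<open>X\<close> only through its law \<open>P\<close>, a Borel
  probability measure on \<open>\<real>\<^sup>n\<close>. They are defined in terms of the law, which also keeps the type
  of the sample space out of the choice of the absolute constant. An independent copy \<open>Y\<close> of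
  \<open>X\<close> amounts to the pair \<open>(X, Y)\<close> having law \<open>P \<Otimes>\<^sub>M P\<close>; the lemmas at the end translate
  back to random vectors on an arbitrary probability space.
\<close>

definition vector_law :: "nat \<Rightarrow> (nat \<Rightarrow> real) measure \<Rightarrow> bool" where
  "vector_law n P \<longleftrightarrow> prob_space P \<and> sets P = sets (Rn n)"

definition proj_cdf :: "nat \<Rightarrow> (nat \<Rightarrow> real) measure \<Rightarrow> (nat \<Rightarrow> real) \<Rightarrow> real \<Rightarrow> real" where
  "proj_cdf n P \<theta> = cdf (distr P borel (\<lambda>x. vinner n x \<theta>))"

definition typical_cdf :: "nat \<Rightarrow> (nat \<Rightarrow> real) measure \<Rightarrow> real \<Rightarrow> real" where
  "typical_cdf n P x = (\<integral>\<theta>. proj_cdf n P \<theta> x \<partial>unif_sphere n)"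

definition omega :: "(real \<Rightarrow> real) \<Rightarrow> (real \<Rightarrow> real) \<Rightarrow> real" where
  "omega U V = sqrt (\<integral>x. (U x - V x)\<^sup>2 \<partial>lborel)"

text \<open>\<open>\<sigma>\<^sub>4\<^sup>2\<close> takes values in \<open>[0, \<infinity>]\<close>: the variance of \<open>|X|\<^sup>2\<close> may be infinite.\<close>

definition sigma4_sq :: "nat \<Rightarrow> (nat \<Rightarrow> real) measure \<Rightarrow> ennreal" where
  "sigma4_sq n P =
     (\<integral>\<^sup>+x. ennreal (((vnorm n x)\<^sup>2 - (\<integral>y. (vnorm n y)\<^sup>2 \<partial>P))\<^sup>2) \<partial>P) / of_nat n"

definition R_fun :: "nat \<Rightarrow> (nat \<Rightarrow> real) \<Rightarrow> (nat \<Rightarrow> real) \<Rightarrow> real" where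
  "R_fun n x y =
     sqrt ((vnorm n x)\<^sup>2 + (vnorm n y)\<^sup>2) / sqrt (real n) * (1 + 1 / (8 * real n))
     - vnorm n (\<lambda>i. x i - y i) / sqrt (real n) * (1 + 1 / (4 * real n))"


lemma measurable_Rn_component [measurable]:
  "i < n \<Longrightarrow> (\<lambda>x. x i) \<in> borel_measurable (Rn n)"
  unfolding Rn_def using measurable_component_singleton[of i "{..<n}" "\<lambda>_. lborel"] by simp

lemma measurable_vnorm [measurable]: "vnorm n \<in> borel_measurable (Rn n)"
  unfolding vnorm_def[abs_def] L2_set_def by measurable

lemma measurable_vinner [measurable]: "(\<lambda>x. vinner n x \<theta>) \<in> borel_measurable (Rn n)"
  unfolding vinner_def by measurable

lemma measurable_R_fun [measurable]:
  "(\<lambda>(x, y). R_fun n x y) \<in> borel_measurable (Rn n \<Otimes>\<^sub>M Rn n)"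
proof -
  have [measurable]: "(\<lambda>p. fst p i) \<in> borel_measurable (Rn n \<Otimes>\<^sub>M Rn n)"
    "(\<lambda>p. snd p i) \<in> borel_measurable (Rn n \<Otimes>\<^sub>M Rn n)" if "i < n" for i
    using measurable_compose[OF measurable_fst measurable_Rn_component[OF that]]
      measurable_compose[OF measurable_snd measurable_Rn_component[OF that]] by auto
  have [measurable]: "(\<lambda>p. vnorm n (\<lambda>i. fst p i - snd p i)) \<in> borel_measurable (Rn n \<Otimes>\<^sub>M Rn n)"
    unfolding vnorm_def L2_set_def
    by (intro measurable_compose[OF _ borel_measurable_sqrt] borel_measurable_sum borel_measurable_power
        borel_measurable_diff) auto
  show ?thesis unfolding R_fun_def case_prod_beta by measurable
qed

lemma measurable_radial:
  "(\<lambda>x. \<lambda>i\<in>{..<n}. x i / vnorm n x) \<in> Rn n \<rightarrow>\<^sub>M Rn n"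
  by (subst (2) Rn_def) (rule measurable_restrict, simp, measurable)

lemma emeasure_unit_ball:
  "emeasure (Rn n) {x \<in> space (Rn n). vnorm n x \<le> 1} = ennreal (unit_ball_vol (real n))"
  using emeasure_cball_aux[of "{..<n}" 1]
  by (simp add: Rn_def vnorm_def L2_set_def Int_def conj_commute)

lemma prob_space_unif_sphere: "prob_space (unif_sphere n)"
proof -
  have "prob_space (uniform_measure (Rn n) {x \<in> space (Rn n). vnorm n x \<le> 1})"
    by (rule prob_space_uniform_measure) (auto simp: emeasure_unit_ball less_imp_neq[symmetric])
  then show ?thesis
    unfolding unif_sphere_def
    by (rule prob_space.prob_space_distr) (use measurable_radial in \<open>simp add: measurable_def\<close>)
qed

lemma proj_cdf_distr:
  assumes "X \<in> M \<rightarrow>\<^sub>M Rn n"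
  shows "proj_cdf n (distr M (Rn n) X) \<theta> x = measure M {\<omega> \<in> space M. vinner n (X \<omega>) \<theta> \<le> x}"
proof -
  have [measurable]: "X \<in> M \<rightarrow>\<^sub>M Rn n" by fact
  show ?thesis
    unfolding proj_cdf_def cdf_def
    by (auto simp: distr_distr measure_distr comp_def intro!: arg_cong[where f = "measure M"])
qed

lemma sigma4_sq_distr:
  assumes "X \<in> M \<rightarrow>\<^sub>M Rn n"
  shows "sigma4_sq n (distr M (Rn n) X) =
    (\<integral>\<^sup>+\<omega>. ennreal (((vnorm n (X \<omega>))\<^sup>2 - (\<integral>\<eta>. (vnorm n (X \<eta>))\<^sup>2 \<partial>M))\<^sup>2) \<partial>M) / of_nat n"
proof -
  have [measurable]: "X \<in> M \<rightarrow>\<^sub>M Rn n" by fact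
  show ?thesis
    unfolding sigma4_sq_def by (simp add: integral_distr nn_integral_distr)
qed

lemma (in prob_space) integral_R_fun_indep_copy:
  assumes "indep_var (Rn n) X (Rn n) Y" and "distr M (Rn n) Y = distr M (Rn n) X"
  shows "(\<integral>(x, y). R_fun n x y \<partial>(distr M (Rn n) X \<Otimes>\<^sub>M distr M (Rn n) X)) =
         expectation (\<lambda>\<omega>. R_fun n (X \<omega>) (Y \<omega>))"
proof -
  have [measurable]: "random_variable (Rn n) X" "random_variable (Rn n) Y"
    using assms(1) indep_var_distribution_eq by blast+
  have "distr M (Rn n) X \<Otimes>\<^sub>M distr M (Rn n) X = distr M (Rn n \<Otimes>\<^sub>M Rn n) (\<lambda>\<omega>. (X \<omega>, Y \<omega>))"
    using assms indep_var_distribution_eq by metis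
  then show ?thesis
    by (simp add: integral_distr)
qed

end

theory Submission
  imports Defs
begin

text \<open>
  Two identities reduce the statement to a computation with two independent uniform directions
  \<open>\<theta>\<close> and \<open>\<theta>'\<close>. As \<open>F\<close> is the mean of the \<open>F\<^sub>\<theta>\<close>, the variance formula
  gives \<open>E\<^sub>\<theta> (F\<^sub>\<theta> - F)\<^sup>2 = F (1 - F) - E\<^sub>\<theta> F\<^sub>\<theta> (1 - F\<^sub>\<theta>)\<close> pointwise, and for a
  distribution function \<open>G\<close> of \<open>Z\<close> the integral of \<open>2 G (1 - G)\<close> over the line is
  \<open>E |Z - Z'|\<close>, with \<open>Z'\<close> an independent copy of \<open>Z\<close>. Hence
  \<open>2 E\<^sub>\<theta> \<omega>\<^sup>2(F\<^sub>\<theta>, F) = E |<X,\<theta>> - <Y,\<theta>'>| - E |<X - Y,\<theta>>|\<close> (\<open>energy_decomposition\<close>).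

  By rotation invariance \<open>E\<^sub>\<theta> |<x,\<theta>>| = \<kappa> |x|\<close> with a constant \<open>\<kappa>\<close> depending on \<open>n\<close> only,
  which settles the second term. In the first one \<open>x\<close> and \<open>y\<close> may be replaced by \<open>|x| w\<close>
  and \<open>|y| w\<close> for a unit vector \<open>w\<close>; averaging over \<open>w\<close> as well leaves
  \<open>\<kappa> E | |x| \<theta> - |y| \<theta>' |\<close>. With \<open>q = |x|\<^sup>2 + |y|\<^sup>2\<close>, \<open>\<rho> = 2 |x| |y| / q\<close> and
  \<open>T = <\<theta>,\<theta>'>\<close> this is \<open>\<kappa> sqrt q E sqrt (1 - \<rho> T)\<close> (\<open>nn_sphere_pair\<close>). The odd moments of
  \<open>T\<close> vanish, \<open>E T\<^sup>2 = 1 / n\<close> and \<open>E T ^ 4 = O(1 / n\<^sup>2)\<close>, so a Taylor expansion gives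
  \<open>\<kappa> sqrt q (1 - \<rho>\<^sup>2 / (8 n) + O(1 / n\<^sup>2))\<close> (\<open>sphere_pair_mean_approx\<close>). Since
  \<open>\<kappa> = sqrt (2 / (\<pi> n)) (1 + 1 / (4 n) + O(1 / n\<^sup>2))\<close> (\<open>sphere_abs_mean_asymp\<close>), the case \<open>\<rho> = 1\<close>
  yields the factors \<open>1 + 1 / (8 n)\<close> and \<open>1 + 1 / (4 n)\<close> in \<open>R\<close> up to \<open>O(1 / n\<^sup>2)\<close>. The price for putting
  \<open>\<rho> = 1\<close> is \<open>sqrt (q / n) (1 - \<rho>\<^sup>2) / (8 n)\<close>, and \<open>1 - \<rho>\<^sup>2 = (|x|\<^sup>2 - |y|\<^sup>2)\<^sup>2 / q\<^sup>2\<close> makes its mean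
  at most \<open>\<sigma>\<^sub>4\<^sup>2 / (2 n\<^sup>2)\<close> (\<open>anisotropy_bound\<close>).

  The facts about the sphere are drawn from a standard Gaussian vector \<open>G\<close>. The way Lebesgue
  measure scales already makes the direction of \<open>G\<close> uniform and independent of \<open>|G|\<close>. As
  \<open><G,x>\<close> is distributed like \<open>|x|\<close> times a standard normal variable, the moments of
  \<open><x,\<theta>>\<close> come out by dividing by those of \<open>|G|\<close>; they depend on \<open>x\<close> only through \<open>|x|\<close>, and
  as the variable is bounded, so does its whole law, by Weierstrass approximation
  (\<open>sphere_integral_vinner_cong\<close>). In particular \<open>\<kappa> = sqrt (2 / \<pi>) / E |G|\<close>, and \<open>E |G|\<close> follows
  from the first four central moments of \<open>|G|\<^sup>2\<close> by the same Taylor expansion of the square root.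
\<close>

section \<open>Euclidean norm and inner product\<close>

lemma space_Rn: "space (Rn n) = {..<n} \<rightarrow>\<^sub>E UNIV"
  by (simp add: Rn_def space_PiM)

lemma vnorm_nonneg [simp]: "0 \<le> vnorm n x"
  by (simp add: vnorm_def)

lemma vnorm_sq: "(vnorm n x)\<^sup>2 = (\<Sum>i<n. (x i)\<^sup>2)"
  by (simp add: vnorm_def L2_set_def sum_nonneg)

lemma vnorm_cong: "(\<And>i. i < n \<Longrightarrow> x i = y i) \<Longrightarrow> vnorm n x = vnorm n y"
  by (auto simp: vnorm_def intro: L2_set_cong)

lemma vnorm_scale: "0 \<le> t \<Longrightarrow> vnorm n (\<lambda>i. t * x i) = t * vnorm n x"
  by (simp add: vnorm_def L2_set_right_distrib)

lemma vinner_commute: "vinner n x y = vinner n y x"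
  by (simp add: vinner_def mult.commute)

lemma abs_vinner_le: "\<bar>vinner n x y\<bar> \<le> vnorm n x * vnorm n y"
proof -
  have "\<bar>vinner n x y\<bar> \<le> (\<Sum>i<n. \<bar>x i\<bar> * \<bar>y i\<bar>)"
    unfolding vinner_def by (rule order_trans[OF sum_abs]) (simp add: abs_mult)
  also have "\<dots> \<le> vnorm n x * vnorm n y" unfolding vnorm_def by (rule L2_set_mult_ineq)
  finally show ?thesis .
qed

lemma vinner_lincomb: "vinner n (\<lambda>i. r * x i - s * y i) w = r * vinner n x w - s * vinner n y w"
  by (simp add: vinner_def sum_subtractf sum_distrib_left left_diff_distrib mult.assoc)

lemma vnorm_lincomb_sq:
  "(vnorm n (\<lambda>i. r * x i - s * y i))\<^sup>2 = r\<^sup>2 * (vnorm n x)\<^sup>2 + s\<^sup>2 * (vnorm n y)\<^sup>2 - 2 * r * s * vinner n x y"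
proof -
  have "(vnorm n (\<lambda>i. r * x i - s * y i))\<^sup>2 = (\<Sum>i<n. r\<^sup>2 * (x i)\<^sup>2 + s\<^sup>2 * (y i)\<^sup>2 - 2 * r * s * (x i * y i))"
    unfolding vnorm_sq by (intro sum.cong) (auto simp: power2_eq_square algebra_simps)
  then show ?thesis by (simp add: vnorm_sq vinner_def sum.distrib sum_subtractf sum_distrib_left)
qed

lemma vnorm_lincomb:
  "vnorm n (\<lambda>i. r * x i - s * y i) = sqrt (r\<^sup>2 * (vnorm n x)\<^sup>2 + s\<^sup>2 * (vnorm n y)\<^sup>2 - 2 * r * s * vinner n x y)"
  unfolding vnorm_lincomb_sq[symmetric] by simp

lemma vnorm_diff_le: "vnorm n (\<lambda>i. x i - y i) \<le> 2 * sqrt ((vnorm n x)\<^sup>2 + (vnorm n y)\<^sup>2)"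
proof -
  have "(vnorm n (\<lambda>i. x i - y i))\<^sup>2 \<le> 2 * ((vnorm n x)\<^sup>2 + (vnorm n y)\<^sup>2)"
  proof -
    have "- (2 * vinner n x y) \<le> 2 * (vnorm n x * vnorm n y)" using abs_vinner_le[of n x y] by linarith
    also have "\<dots> \<le> (vnorm n x)\<^sup>2 + (vnorm n y)\<^sup>2" using sum_squares_bound[of "vnorm n x" "vnorm n y"] by (simp add: mult.assoc)
    finally show ?thesis using vnorm_lincomb_sq[of n 1 x 1 y] by simp
  qed
  also have "\<dots> \<le> (2 * sqrt ((vnorm n x)\<^sup>2 + (vnorm n y)\<^sup>2))\<^sup>2"
    by (simp add: power_mult_distrib)
  finally show ?thesis by (rule power2_le_imp_le) simp
qed

lemma measurable_vinner_right [measurable]: "vinner n x \<in> borel_measurable (Rn n)"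
  unfolding vinner_def[abs_def] by measurable

lemma measurable_vinner_pair [measurable (raw)]:
  assumes "f \<in> M \<rightarrow>\<^sub>M Rn n" "g \<in> M \<rightarrow>\<^sub>M Rn n"
  shows "(\<lambda>x. vinner n (f x) (g x)) \<in> borel_measurable M"
  unfolding vinner_def
  by (intro borel_measurable_sum borel_measurable_times
      measurable_compose[OF assms(1) measurable_Rn_component] measurable_compose[OF assms(2) measurable_Rn_component]) auto

lemma measurable_vnorm_diff [measurable (raw)]:
  assumes "f \<in> M \<rightarrow>\<^sub>M Rn n" "g \<in> M \<rightarrow>\<^sub>M Rn n"
  shows "(\<lambda>x. vnorm n (\<lambda>i. f x i - g x i)) \<in> borel_measurable M"
  unfolding vnorm_def L2_set_def
  by (intro measurable_compose[OF _ borel_measurable_sqrt] borel_measurable_sum borel_measurable_power borel_measurable_diff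
      measurable_compose[OF assms(1) measurable_Rn_component] measurable_compose[OF assms(2) measurable_Rn_component]) auto

section \<open>Lebesgue measure in polar form\<close>

definition radial :: "nat \<Rightarrow> (nat \<Rightarrow> real) \<Rightarrow> nat \<Rightarrow> real" where
  "radial n x = (\<lambda>i\<in>{..<n}. x i / vnorm n x)"

lemma measurable_radial_map [measurable]: "radial n \<in> Rn n \<rightarrow>\<^sub>M Rn n"
  unfolding radial_def[abs_def] by (rule measurable_radial)

lemma vinner_radial: "vinner n x y = vinner n x (radial n y) * vnorm n y"
proof (cases "vnorm n y = 0")
  case True
  then show ?thesis using abs_vinner_le[of n x y] by simp
next
  case False
  then show ?thesis by (simp add: vinner_def radial_def sum_distrib_right)
qed

lemma emeasure_ball_Rn:
  "t > 0 \<Longrightarrow> emeasure (Rn n) {x \<in> space (Rn n). vnorm n x \<le> t} = ennreal (unit_ball_vol (real n) * t ^ n)"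
  using emeasure_cball_aux[of "{..<n}" t]
  by (simp add: Rn_def vnorm_def L2_set_def Int_def conj_commute)

lemma null_origin:
  assumes "n \<ge> 1"
  shows "emeasure (Rn n) {x \<in> space (Rn n). vnorm n x = 0} = 0"
proof -
  interpret product_sigma_finite "\<lambda>_. lborel :: real measure" by standard
  have "{x \<in> space (Rn n). vnorm n x = 0} \<subseteq> (\<Pi>\<^sub>E i\<in>{..<n}. {0})"
    by (auto simp: space_Rn PiE_def vnorm_def L2_set_eq_0_iff Pi_def extensional_def fun_eq_iff)
  then have "emeasure (Rn n) {x \<in> space (Rn n). vnorm n x = 0} \<le> emeasure (Rn n) (\<Pi>\<^sub>E i\<in>{..<n}. {0})"
    by (rule emeasure_mono) (unfold Rn_def, rule sets_PiM_I_finite, auto)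
  also have "\<dots> = (\<Prod>i\<in>{..<n}. emeasure lborel {0::real})"
    unfolding Rn_def by (rule emeasure_PiM) auto
  also have "\<dots> = 0" using assms by (auto intro!: prod_zero bexI[of _ 0])
  finally show ?thesis by simp
qed

lemma AE_vnorm_pos: "n \<ge> 1 \<Longrightarrow> AE x in Rn n. vnorm n x > 0"
  by (rule AE_I'[of "{x \<in> space (Rn n). vnorm n x = 0}"])
     (auto simp: null_sets_def null_origin less_le)

text \<open>
  Scaling is checked on boxes, where it is the one-dimensional rule in each coordinate.
\<close>

lemma distr_Rn_scale:
  assumes "t > 0"
  shows "Rn n = scale_measure (ennreal (t ^ n)) (distr (Rn n) (Rn n) (\<lambda>x. \<lambda>i\<in>{..<n}. t * x i))"
proof -
  interpret product_sigma_finite "\<lambda>_. lborel :: real measure" by standard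
  have m [measurable]: "(\<lambda>x. \<lambda>i\<in>{..<n}. t * x i) \<in> Rn n \<rightarrow>\<^sub>M Rn n"
    by (subst (2) Rn_def) (rule measurable_restrict, simp)
  have "scale_measure (ennreal (t ^ n)) (distr (Rn n) (Rn n) (\<lambda>x. \<lambda>i\<in>{..<n}. t * x i))
     = (\<Pi>\<^sub>M i\<in>{..<n}. lborel)"
  proof (rule PiM_eqI)
    fix A :: "nat \<Rightarrow> real set"
    assume A: "\<And>i. i \<in> {..<n} \<Longrightarrow> A i \<in> sets lborel"
    have pre: "(\<lambda>x. t * x) -` A i \<in> sets borel" if "i < n" for i
      using measurable_sets[of "\<lambda>x. t * x" borel borel "A i"] A[of i] that by auto
    have one: "ennreal t * emeasure lborel ((\<lambda>x. t * x) -` A i) = emeasure lborel (A i)" if "i < n" for i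
    proof -
      have "emeasure lborel (A i) = emeasure (density (distr lborel borel ((*) t)) (\<lambda>_. \<bar>t\<bar>)) (A i)"
        using lborel_distr_mult'[of t] assms by simp
      also have "\<dots> = ennreal t * emeasure (distr lborel borel ((*) t)) (A i)"
        using A[of i] that assms by (subst emeasure_density) (auto simp: nn_integral_cmult)
      also have "\<dots> = ennreal t * emeasure lborel ((\<lambda>x. t * x) -` A i)"
        using A[of i] that by (subst emeasure_distr) auto
      finally show ?thesis by simp
    qed
    have S: "Pi\<^sub>E {..<n} A \<in> sets (Rn n)"
      unfolding Rn_def using A by (intro sets_PiM_I_finite) auto
    have "(\<lambda>x. \<lambda>i\<in>{..<n}. t * x i) -` Pi\<^sub>E {..<n} A \<inter> space (Rn n) = (\<Pi>\<^sub>E i\<in>{..<n}. (\<lambda>x. t * x) -` A i)"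
      by (auto simp: space_Rn PiE_def Pi_def)
    then have "emeasure (distr (Rn n) (Rn n) (\<lambda>x. \<lambda>i\<in>{..<n}. t * x i)) (Pi\<^sub>E {..<n} A) =
      (\<Prod>i<n. emeasure lborel ((\<lambda>x. t * x) -` A i))"
      using pre by (subst emeasure_distr[OF m S]) (simp add: Rn_def, subst emeasure_PiM, auto)
    moreover have "ennreal (t ^ n) = (\<Prod>i<n. ennreal t)"
      using assms by (simp add: ennreal_power)
    moreover have "(\<Prod>i<n. emeasure lborel (A i)) = (\<Prod>i<n. ennreal t * emeasure lborel ((\<lambda>x. t * x) -` A i))"
      using one by (intro prod.cong) auto
    ultimately show "emeasure (scale_measure (ennreal (t ^ n)) (distr (Rn n) (Rn n) (\<lambda>x. \<lambda>i\<in>{..<n}. t * x i)))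
       (Pi\<^sub>E {..<n} A) = (\<Prod>i\<in>{..<n}. emeasure lborel (A i))"
      by (simp add: prod.distrib)
  qed (auto simp: Rn_def)
  then show ?thesis by (simp add: Rn_def)
qed

lemma sets_unif_sphere [simp, measurable_cong]: "sets (unif_sphere n) = sets (Rn n)"
  by (simp add: unif_sphere_def)

lemma space_unif_sphere [simp]: "space (unif_sphere n) = space (Rn n)"
  by (simp add: unif_sphere_def)

lemma unif_sphere_eq_radial:
  "unif_sphere n = distr (uniform_measure (Rn n) {x \<in> space (Rn n). vnorm n x \<le> 1}) (Rn n) (radial n)"
  by (simp add: unif_sphere_def radial_def[abs_def])

text \<open>
  Intersecting the cone over \<open>A\<close> with a ball of radius \<open>t\<close> is the \<open>t\<close>-dilate of its intersection with
  the unit ball, and the latter defines the uniform measure of \<open>A\<close>.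
\<close>

lemma emeasure_cone:
  assumes A[measurable]: "A \<in> sets (Rn n)" and "t > 0"
  shows "emeasure (Rn n) {x \<in> space (Rn n). vnorm n x \<le> t \<and> radial n x \<in> A}
    = emeasure (unif_sphere n) A * ennreal (unit_ball_vol (real n) * t ^ n)"
proof -
  let ?B = "{x \<in> space (Rn n). vnorm n x \<le> 1}"
  let ?T = "\<lambda>x. \<lambda>i\<in>{..<n}. t * x i"
  have m [measurable]: "?T \<in> Rn n \<rightarrow>\<^sub>M Rn n"
    by (subst (2) Rn_def) (rule measurable_restrict, simp)
  have ns: "vnorm n (?T x) = t * vnorm n x" for x
    using vnorm_scale[of t n x] \<open>t > 0\<close> vnorm_cong[of n "?T x" "\<lambda>i. t * x i"] by simp
  have rs: "radial n (?T x) = radial n x" for x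
    unfolding radial_def ns using \<open>t > 0\<close> by (auto simp: fun_eq_iff)
  let ?C = "{x \<in> space (Rn n). vnorm n x \<le> 1 \<and> radial n x \<in> A}"
  have u: "emeasure (unif_sphere n) A = emeasure (Rn n) ?C / ennreal (unit_ball_vol (real n))"
  proof -
    have "?B \<inter> (radial n -` A \<inter> space (Rn n)) = ?C" by auto
    then show ?thesis
      unfolding unif_sphere_eq_radial
      by (subst emeasure_distr, measurable) (auto simp: emeasure_unit_ball)
  qed
  have "emeasure (Rn n) ?C = emeasure (unif_sphere n) A * ennreal (unit_ball_vol (real n))"
    unfolding u by (simp add: ennreal_divide_times mult_divide_eq_ennreal less_imp_neq[symmetric])
  moreover have "emeasure (Rn n) {x \<in> space (Rn n). vnorm n x \<le> t \<and> radial n x \<in> A}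
    = ennreal (t ^ n) * emeasure (Rn n) ?C"
  proof -
    have "?T -` {x \<in> space (Rn n). vnorm n x \<le> t \<and> radial n x \<in> A} \<inter> space (Rn n) = ?C"
      using \<open>t > 0\<close> by (auto simp: ns rs, auto simp: space_Rn)
    then show ?thesis
      by (subst distr_Rn_scale[OF \<open>t > 0\<close>]) (simp add: emeasure_distr)
  qed
  ultimately show ?thesis using \<open>t > 0\<close>
    by (simp add: ennreal_mult mult_ac)
qed

text \<open>
  The law of the norm on the cone over \<open>A\<close> is proportional to its law on the whole space, because by
  \<open>emeasure_cone\<close> the two agree, up to the factor, on all half-lines \<open>{..t}\<close>.
\<close>

lemma distr_vnorm_cone:
  assumes A[measurable]: "A \<in> sets (Rn n)" and "n \<ge> 1"
  shows "distr (density (Rn n) (\<lambda>x. indicator A (radial n x))) borel (vnorm n)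
    = scale_measure (emeasure (unif_sphere n) A) (distr (Rn n) borel (vnorm n))" (is "?M = ?N")
proof (rule measure_eqI_generator_eq[where \<Omega>=UNIV and E="range (\<lambda>t::real. {..t})" and A="\<lambda>i. {..real i}"])
  show "Int_stable (range (\<lambda>t::real. {..t}))"
    by (auto simp: Int_stable_def)
  have e1: "emeasure ?M {..t} = emeasure (Rn n) {x \<in> space (Rn n). vnorm n x \<le> t \<and> radial n x \<in> A}" for t
  proof -
    have "emeasure ?M {..t} = (\<integral>\<^sup>+x. indicator A (radial n x) * indicator (vnorm n -` {..t} \<inter> space (Rn n)) x \<partial>Rn n)"
      by (simp add: emeasure_distr emeasure_density)
    also have "\<dots> = (\<integral>\<^sup>+x. indicator {x \<in> space (Rn n). vnorm n x \<le> t \<and> radial n x \<in> A} x \<partial>Rn n)"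
      by (intro nn_integral_cong) (auto simp: indicator_def)
    finally show ?thesis by simp
  qed
  have e2: "emeasure ?N {..t} = emeasure (unif_sphere n) A * emeasure (Rn n) {x \<in> space (Rn n). vnorm n x \<le> t}" for t
  proof -
    have "vnorm n -` {..t} \<inter> space (Rn n) = {x \<in> space (Rn n). vnorm n x \<le> t}" by auto
    then show ?thesis by (simp add: emeasure_distr)
  qed
  fix X assume "X \<in> range (\<lambda>t::real. {..t})"
  then obtain t where t: "X = {..t}" by auto
  show "emeasure ?M X = emeasure ?N X"
  proof (cases "t > 0")
    case True
    then show ?thesis unfolding t e1 e2 emeasure_cone[OF A True] by (simp add: emeasure_ball_Rn)
  next
    case False
    have "emeasure (Rn n) {x \<in> space (Rn n). vnorm n x \<le> t} \<le> emeasure (Rn n) {x \<in> space (Rn n). vnorm n x = 0}"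
      using False by (intro emeasure_mono) (auto intro: antisym order_trans[OF _ iffD1[OF not_less]])
    then have z: "emeasure (Rn n) {x \<in> space (Rn n). vnorm n x \<le> t} = 0"
      using null_origin[OF \<open>n \<ge> 1\<close>] by simp
    have "emeasure (Rn n) {x \<in> space (Rn n). vnorm n x \<le> t \<and> radial n x \<in> A} \<le> emeasure (Rn n) {x \<in> space (Rn n). vnorm n x \<le> t}"
      by (intro emeasure_mono) auto
    then show ?thesis unfolding t e1 e2 using z by simp
  qed
next
  fix i :: nat
  have "emeasure (distr (density (Rn n) (\<lambda>x. indicator A (radial n x))) borel (vnorm n)) {..real i}
     \<le> emeasure (Rn n) {x \<in> space (Rn n). vnorm n x \<le> real i + 1}"
  proof -
    have "emeasure ?M {..real i} = (\<integral>\<^sup>+x. indicator A (radial n x) * indicator (vnorm n -` {..real i} \<inter> space (Rn n)) x \<partial>Rn n)"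
      by (simp add: emeasure_distr emeasure_density)
    also have "\<dots> \<le> (\<integral>\<^sup>+x. indicator {x \<in> space (Rn n). vnorm n x \<le> real i + 1} x \<partial>Rn n)"
      by (intro nn_integral_mono) (auto simp: indicator_def)
    finally show ?thesis by simp
  qed
  then show "emeasure ?M {..real i} \<noteq> \<infinity>"
    using emeasure_ball_Rn[of "real i + 1" n] by (auto simp: top_unique)
next
  show "(\<Union>i. {..real i}) = UNIV" by (auto intro: real_arch_simple)
qed (auto simp: borel_eq_atMost)

section \<open>Standard Gaussian vectors\<close>

definition gauss :: "nat \<Rightarrow> (nat \<Rightarrow> real) measure" where
  "gauss n = (\<Pi>\<^sub>M i\<in>{..<n}. density lborel std_normal_density)"

lemma sets_gauss [simp, measurable_cong]: "sets (gauss n) = sets (Rn n)"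
  unfolding gauss_def Rn_def by (intro sets_PiM_cong) auto

lemma space_gauss [simp]: "space (gauss n) = space (Rn n)"
  by (rule sets_eq_imp_space_eq) simp

lemma prob_space_gauss: "prob_space (gauss n)"
  unfolding gauss_def by (rule prob_space_PiM) (auto intro: prob_space_normal_density)

definition gauss_radial_density :: "nat \<Rightarrow> real \<Rightarrow> real" where
  "gauss_radial_density n r = (1 / sqrt (2 * pi)) ^ n * exp (- r\<^sup>2 / 2)"

lemma measurable_gauss_radial_density [measurable]: "gauss_radial_density n \<in> borel_measurable borel"
  unfolding gauss_radial_density_def by measurable

lemma gauss_eq_density: "gauss n = density (Rn n) (\<lambda>x. gauss_radial_density n (vnorm n x))"
proof -
  interpret L: product_sigma_finite "\<lambda>_. lborel :: real measure" by standard
  have ps: "prob_space (density lborel std_normal_density)" by (rule prob_space_normal_density) simp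
  interpret G: product_sigma_finite "\<lambda>_::nat. density lborel std_normal_density"
    by (intro product_sigma_finite.intro prob_space_imp_sigma_finite ps)
  have dens: "ennreal (gauss_radial_density n (vnorm n x)) = (\<Prod>i<n. ennreal (std_normal_density (x i)))" for x
  proof -
    have "(\<Prod>i<n. std_normal_density (x i)) = (1 / sqrt (2*pi)) ^ n * exp (\<Sum>i<n. - (x i)\<^sup>2 / 2)"
      by (simp add: std_normal_density_def prod.distrib exp_sum prod_dividef power_divide)
    also have "(\<Sum>i<n. - (x i)\<^sup>2 / 2) = - (vnorm n x)\<^sup>2 / 2"
      by (simp add: vnorm_sq sum_divide_distrib sum_negf)
    finally show ?thesis by (simp add: gauss_radial_density_def prod_ennreal)
  qed
  have "density (Rn n) (\<lambda>x. gauss_radial_density n (vnorm n x)) = (\<Pi>\<^sub>M i\<in>{..<n}. density lborel std_normal_density)"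
  proof (rule G.PiM_eqI)
    show "sets (density (Rn n) (\<lambda>x. gauss_radial_density n (vnorm n x))) = sets (\<Pi>\<^sub>M i\<in>{..<n}. density lborel std_normal_density)"
      using sets_gauss[of n] by (simp add: gauss_def)
    fix A :: "nat \<Rightarrow> real set"
    assume A: "\<And>i. i \<in> {..<n} \<Longrightarrow> A i \<in> sets (density lborel std_normal_density)"
    have S: "Pi\<^sub>E {..<n} A \<in> sets (Rn n)"
      unfolding Rn_def using A by (intro sets_PiM_I_finite) auto
    have "emeasure (density (Rn n) (\<lambda>x. gauss_radial_density n (vnorm n x))) (Pi\<^sub>E {..<n} A)
      = (\<integral>\<^sup>+x. ennreal (gauss_radial_density n (vnorm n x)) * indicator (Pi\<^sub>E {..<n} A) x \<partial>Rn n)"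
      using S by (subst emeasure_density) auto
    also have "\<dots> = (\<integral>\<^sup>+x. (\<Prod>i<n. ennreal (std_normal_density (x i)) * indicator (A i) (x i)) \<partial>Rn n)"
    proof (intro nn_integral_cong)
      fix x assume x: "x \<in> space (Rn n)"
      have "(indicator (Pi\<^sub>E {..<n} A) x :: ennreal) = (\<Prod>i<n. indicator (A i) (x i))"
        using x by (auto simp: indicator_def space_Rn PiE_def Pi_def)
      then show "ennreal (gauss_radial_density n (vnorm n x)) * indicator (Pi\<^sub>E {..<n} A) x =
         (\<Prod>i<n. ennreal (std_normal_density (x i)) * indicator (A i) (x i))"
        by (simp add: dens prod.distrib)
    qed
    also have "\<dots> = (\<Prod>i<n. \<integral>\<^sup>+x. ennreal (std_normal_density x) * indicator (A i) x \<partial>lborel)"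
      unfolding Rn_def using A by (intro L.product_nn_integral_prod) auto
    also have "\<dots> = (\<Prod>i\<in>{..<n}. emeasure (density lborel std_normal_density) (A i))"
      using A by (intro prod.cong) (auto simp: emeasure_density)
    finally show "emeasure (density (Rn n) (\<lambda>x. gauss_radial_density n (vnorm n x))) (Pi\<^sub>E {..<n} A)
      = (\<Prod>i\<in>{..<n}. emeasure (density lborel std_normal_density) (A i))" .
  qed simp
  then show ?thesis by (simp add: gauss_def)
qed

lemma AE_gauss_if_AE_Rn: "AE x in Rn n. P x \<Longrightarrow> AE x in gauss n. P x"
  unfolding gauss_eq_density by (subst AE_density, measurable) (auto elim: eventually_mono)

text \<open>
  The radial density can be integrated against \<open>distr_vnorm_cone\<close>: direction and norm of a Gaussian
  vector are independent, and the direction is uniform.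
\<close>

lemma gauss_polar:
  assumes [measurable]: "A \<in> sets (Rn n)" "B \<in> sets borel" and "n \<ge> 1"
  shows "emeasure (gauss n) {x \<in> space (Rn n). radial n x \<in> A \<and> vnorm n x \<in> B}
    = emeasure (unif_sphere n) A * emeasure (distr (gauss n) borel (vnorm n)) B"
proof -
  let ?g = "\<lambda>r. ennreal (gauss_radial_density n r) * indicator B r"
  have "emeasure (gauss n) {x \<in> space (Rn n). radial n x \<in> A \<and> vnorm n x \<in> B} =
    (\<integral>\<^sup>+x. ennreal (gauss_radial_density n (vnorm n x)) * indicator {x \<in> space (Rn n). radial n x \<in> A \<and> vnorm n x \<in> B} x \<partial>Rn n)"
    unfolding gauss_eq_density by (subst emeasure_density) auto
  also have "\<dots> = (\<integral>\<^sup>+x. indicator A (radial n x) * ?g (vnorm n x) \<partial>Rn n)"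
    by (intro nn_integral_cong) (auto simp: indicator_def)
  also have "\<dots> = (\<integral>\<^sup>+x. ?g (vnorm n x) \<partial>density (Rn n) (\<lambda>x. indicator A (radial n x)))"
    by (subst nn_integral_density) auto
  also have "\<dots> = (\<integral>\<^sup>+r. ?g r \<partial>distr (density (Rn n) (\<lambda>x. indicator A (radial n x))) borel (vnorm n))"
    by (subst nn_integral_distr) auto
  also have "\<dots> = emeasure (unif_sphere n) A * (\<integral>\<^sup>+r. ?g r \<partial>distr (Rn n) borel (vnorm n))"
    using \<open>n \<ge> 1\<close> by (subst distr_vnorm_cone) (auto simp: nn_integral_scale_measure)
  also have "(\<integral>\<^sup>+r. ?g r \<partial>distr (Rn n) borel (vnorm n)) = (\<integral>\<^sup>+x. ?g (vnorm n x) \<partial>Rn n)"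
    by (subst nn_integral_distr) auto
  also have "\<dots> = emeasure (distr (gauss n) borel (vnorm n)) B"
  proof -
    have "emeasure (distr (gauss n) borel (vnorm n)) B = emeasure (gauss n) (vnorm n -` B \<inter> space (Rn n))"
      by (subst emeasure_distr) auto
    also have "\<dots> = (\<integral>\<^sup>+x. ennreal (gauss_radial_density n (vnorm n x)) * indicator (vnorm n -` B \<inter> space (Rn n)) x \<partial>Rn n)"
      unfolding gauss_eq_density by (subst emeasure_density) auto
    also have "\<dots> = (\<integral>\<^sup>+x. ?g (vnorm n x) \<partial>Rn n)"
      by (intro nn_integral_cong) (auto simp: indicator_def)
    finally show ?thesis by simp
  qed
  finally show ?thesis .
qed

lemma distr_gauss_radial:
  assumes "n \<ge> 1"
  shows "distr (gauss n) (Rn n) (radial n) = unif_sphere n"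
proof (rule measure_eqI)
  fix A assume "A \<in> sets (distr (gauss n) (Rn n) (radial n))"
  then have A [measurable]: "A \<in> sets (Rn n)" by simp
  have "emeasure (distr (gauss n) (Rn n) (radial n)) A
     = emeasure (gauss n) {x \<in> space (Rn n). radial n x \<in> A \<and> vnorm n x \<in> UNIV}"
    by (subst emeasure_distr) (auto intro!: arg_cong[where f="emeasure _"])
  also have "\<dots> = emeasure (unif_sphere n) A"
  proof -
    interpret G: prob_space "distr (gauss n) borel (vnorm n)"
      by (intro prob_space.prob_space_distr prob_space_gauss) auto
    have "emeasure (distr (gauss n) borel (vnorm n)) UNIV = 1"
      using G.emeasure_space_1 by simp
    then show ?thesis using assms by (subst gauss_polar) (auto simp del: emeasure_distr)
  qed
  finally show "emeasure (distr (gauss n) (Rn n) (radial n)) A = emeasure (unif_sphere n) A" .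
qed simp

text \<open>
  Stated for real functions of the direction and of the norm, since \<open>indep_var\<close> relates
  random variables with values in one type.
\<close>

lemma gauss_indep_radial_vnorm:
  fixes f :: "(nat \<Rightarrow> real) \<Rightarrow> real" and g :: "real \<Rightarrow> real"
  assumes "n \<ge> 1" and [measurable]: "f \<in> borel_measurable (Rn n)" "g \<in> borel_measurable borel"
  shows "prob_space.indep_var (gauss n) borel (\<lambda>x. f (radial n x)) borel (\<lambda>x. g (vnorm n x))"
proof -
  interpret prob_space "gauss n" by (rule prob_space_gauss)
  have "distr (gauss n) borel (\<lambda>x. f (radial n x)) \<Otimes>\<^sub>M distr (gauss n) borel (\<lambda>x. g (vnorm n x))
     = distr (gauss n) (borel \<Otimes>\<^sub>M borel) (\<lambda>x. (f (radial n x), g (vnorm n x)))"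
  proof (rule pair_measure_eqI)
    fix A B assume "A \<in> sets (distr (gauss n) borel (\<lambda>x. f (radial n x)))"
      "B \<in> sets (distr (gauss n) borel (\<lambda>x. g (vnorm n x)))"
    then have [measurable]: "A \<in> sets borel" "B \<in> sets borel" by auto
    let ?A = "f -` A \<inter> space (Rn n)" and ?B = "g -` B"
    have [measurable]: "?A \<in> sets (Rn n)" "?B \<in> sets borel"
      using measurable_sets[of g borel borel B] by auto
    have "emeasure (distr (gauss n) borel (\<lambda>x. f (radial n x))) A = emeasure (distr (gauss n) (Rn n) (radial n)) ?A"
      using measurable_space[OF measurable_radial_map]
      by (simp add: emeasure_distr) (auto intro!: arg_cong[where f="emeasure _"])
    moreover have "emeasure (distr (gauss n) borel (\<lambda>x. g (vnorm n x))) B = emeasure (distr (gauss n) borel (vnorm n)) ?B"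
      by (simp add: emeasure_distr) (auto intro!: arg_cong[where f="emeasure _"])
    moreover have "emeasure (distr (gauss n) (borel \<Otimes>\<^sub>M borel) (\<lambda>x. (f (radial n x), g (vnorm n x)))) (A \<times> B)
      = emeasure (gauss n) {x \<in> space (Rn n). radial n x \<in> ?A \<and> vnorm n x \<in> ?B}"
      using measurable_space[OF measurable_radial_map]
      by (subst emeasure_distr) (auto intro!: arg_cong[where f="emeasure _"])
    ultimately show "emeasure (distr (gauss n) borel (\<lambda>x. f (radial n x))) A * emeasure (distr (gauss n) borel (\<lambda>x. g (vnorm n x))) B =
       emeasure (distr (gauss n) (borel \<Otimes>\<^sub>M borel) (\<lambda>x. (f (radial n x), g (vnorm n x)))) (A \<times> B)"
      using gauss_polar[of ?A n ?B] \<open>n \<ge> 1\<close> by (simp add: distr_gauss_radial del: vimage_eq Int_iff)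
  qed (auto intro!: prob_space_imp_sigma_finite prob_space_distr)
  then show ?thesis
    by (subst indep_var_distribution_eq) auto
qed

text \<open>
  The device that carries Gaussian integrals over to the sphere: a function homogeneous of degree \<open>k\<close>
  is the product of a function of the direction and the \<open>k\<close>-th power of the norm.
\<close>

lemma gauss_integral_homogeneous:
  fixes h :: "(nat \<Rightarrow> real) \<Rightarrow> real"
  assumes "n \<ge> 1" and [measurable]: "h \<in> borel_measurable (Rn n)"
    and int: "integrable (unif_sphere n) h" "integrable (gauss n) (\<lambda>x. vnorm n x ^ k)"
    and hom: "\<And>x. x \<in> space (Rn n) \<Longrightarrow> h x = h (radial n x) * vnorm n x ^ k"
  shows "(\<integral>x. h x \<partial>gauss n) = (\<integral>\<theta>. h \<theta> \<partial>unif_sphere n) * (\<integral>x. vnorm n x ^ k \<partial>gauss n)"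
proof -
  interpret prob_space "gauss n" by (rule prob_space_gauss)
  have "indep_var borel (\<lambda>x. h (radial n x)) borel (\<lambda>x. vnorm n x ^ k)"
    by (rule gauss_indep_radial_vnorm[OF \<open>n \<ge> 1\<close>, of h "\<lambda>r. r ^ k"]) auto
  moreover have i: "integrable (gauss n) (\<lambda>x. h (radial n x))"
    using int(1) by (subst (asm) distr_gauss_radial[OF \<open>n \<ge> 1\<close>, symmetric]) (simp add: integrable_distr_eq)
  ultimately have "expectation (\<lambda>x. h (radial n x) * vnorm n x ^ k) =
     expectation (\<lambda>x. h (radial n x)) * expectation (\<lambda>x. vnorm n x ^ k)"
    using int(2) by (intro indep_var_lebesgue_integral)
  moreover have "expectation (\<lambda>x. h (radial n x)) = (\<integral>\<theta>. h \<theta> \<partial>unif_sphere n)"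
    by (subst distr_gauss_radial[OF \<open>n \<ge> 1\<close>, symmetric]) (simp add: integral_distr)
  moreover have "(\<integral>x. h x \<partial>gauss n) = expectation (\<lambda>x. h (radial n x) * vnorm n x ^ k)"
    using hom by (intro Bochner_Integration.integral_cong) auto
  ultimately show ?thesis by simp
qed

lemma gauss_indep_coordinates:
  assumes "n \<ge> 1"
  shows "prob_space.indep_vars (gauss n) (\<lambda>_. borel) (\<lambda>i x. x i) {..<n}"
    and "\<And>i. i < n \<Longrightarrow> distr (gauss n) borel (\<lambda>x. x i) = std_normal_distribution"
proof -
  interpret prob_space "gauss n" by (rule prob_space_gauss)
  have m: "i < n \<Longrightarrow> (\<lambda>x. x i) \<in> borel_measurable (gauss n)" for i
    by measurable
  have d: "distr (gauss n) borel (\<lambda>x. x i) = std_normal_distribution" if "i < n" for i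
  proof -
    have "distr (gauss n) std_normal_distribution (\<lambda>x. x i) = std_normal_distribution"
      unfolding gauss_def using that by (intro distr_PiM_component) (auto intro: prob_space_normal_density)
    moreover have "distr (gauss n) std_normal_distribution (\<lambda>x. x i) = distr (gauss n) borel (\<lambda>x. x i)"
      by (intro distr_cong) auto
    ultimately show ?thesis by simp
  qed
  show "\<And>i. i < n \<Longrightarrow> distr (gauss n) borel (\<lambda>x. x i) = std_normal_distribution" by (rule d)
  have "distr (gauss n) (\<Pi>\<^sub>M i\<in>{..<n}. borel) (\<lambda>x. \<lambda>i\<in>{..<n}. x i) = distr (gauss n) (gauss n) (\<lambda>x. x)"
    by (intro distr_cong refl) (simp_all add: space_Rn PiE_def extensional_restrict, unfold Rn_def, rule sets_PiM_cong, auto)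
  also have "\<dots> = (\<Pi>\<^sub>M i\<in>{..<n}. distr (gauss n) borel (\<lambda>x. x i))"
    using d by (auto simp: gauss_def[of n] distr_id2 intro!: PiM_cong)
  finally show "indep_vars (\<lambda>_. borel) (\<lambda>i x. x i) {..<n}"
    using assms m by (subst indep_vars_iff_distr_eq_PiM') (auto simp: lessThan_empty_iff)
qed

lemma distr_gauss_vinner:
  assumes "n \<ge> 1"
  shows "distr (gauss n) borel (vinner n x) = distr std_normal_distribution borel (\<lambda>z. vnorm n x * z)"
proof (rule Levy_uniqueness)
  interpret prob_space "gauss n" by (rule prob_space_gauss)
  interpret N: real_distribution std_normal_distribution by (rule real_dist_normal_dist)
  show "real_distribution (distr (gauss n) borel (vinner n x))"
    by (rule real_distribution_distr) measurable
  show "real_distribution (distr std_normal_distribution borel (\<lambda>z. vnorm n x * z))"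
  proof -
    have "real_distribution (distr std_normal_distribution borel (\<lambda>z. c * z))" for c
      by (rule N.real_distribution_distr) (intro borel_measurable_times, auto)
    then show ?thesis .
  qed
  have scale: "char (distr M borel (\<lambda>z. c * f z)) t = char (distr M borel f) (t * c)"
    if "f \<in> borel_measurable M" for M :: "'z measure" and f :: "'z \<Rightarrow> real" and c t :: real
    using that by (simp add: char_def integral_distr mult_ac)
  \<comment> \<open>Both characteristic functions are \<open>exp (- t\<^sup>2 |x|\<^sup>2 / 2)\<close>; this form also covers vanishing coordinates of \<open>x\<close>.\<close>
  show "char (distr (gauss n) borel (vinner n x)) = char (distr std_normal_distribution borel (\<lambda>z. vnorm n x * z))"
  proof
    fix t
    have iv: "indep_vars (\<lambda>_. borel) (\<lambda>i y. x i * y i) {..<n}"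
      using indep_vars_compose2[OF gauss_indep_coordinates(1)[OF assms], of "\<lambda>i z. x i * z" "\<lambda>_. borel"] by simp
    have "char (distr (gauss n) borel (vinner n x)) t = (\<Prod>i<n. char (distr (gauss n) borel (\<lambda>y. x i * y i)) t)"
      unfolding vinner_def[abs_def] using char_distr_sum[OF iv] by simp
    also have "\<dots> = (\<Prod>i<n. complex_of_real (exp (- (t * x i)\<^sup>2 / 2)))"
      by (intro prod.cong refl, subst scale)
         (auto simp: gauss_indep_coordinates(2)[OF assms] char_std_normal_distribution)
    also have "\<dots> = complex_of_real (exp (\<Sum>i<n. - (t * x i)\<^sup>2 / 2))"
      by (simp add: exp_sum)
    also have "(\<Sum>i<n. - (t * x i)\<^sup>2 / 2) = - (t * vnorm n x)\<^sup>2 / 2"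
      by (simp add: vnorm_sq power_mult_distrib sum_distrib_left sum_divide_distrib sum_negf)
    also have "complex_of_real (exp (- (t * vnorm n x)\<^sup>2 / 2)) = char (distr std_normal_distribution borel (\<lambda>z. vnorm n x * z)) t"
      using scale[of "\<lambda>z. z" std_normal_distribution "vnorm n x" t]
      by (simp add: distr_id2 char_std_normal_distribution)
    finally show "char (distr (gauss n) borel (vinner n x)) t = char (distr std_normal_distribution borel (\<lambda>z. vnorm n x * z)) t" .
  qed
qed

lemma gauss_vinner_integral:
  assumes "n \<ge> 1" and [measurable]: "f \<in> borel_measurable borel"
  shows "(\<integral>y. f (vinner n x y) \<partial>gauss n) = (\<integral>z. (f (vnorm n x * z) :: real) \<partial>std_normal_distribution)"
proof -
  have "(\<integral>y. f (vinner n x y) \<partial>gauss n) = (\<integral>z. f z \<partial>distr (gauss n) borel (vinner n x))"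
    by (subst integral_distr) auto
  then show ?thesis
    unfolding distr_gauss_vinner[OF assms(1)] by (subst (asm) integral_distr) auto
qed

section \<open>The mean norm of a Gaussian vector\<close>

text \<open>
  Induction on the number of summands: expand \<open>(y + S) ^ k\<close>, factorise the mixed moments by
  independence, and drop those that contain a first moment.
\<close>

lemma (in prob_space) indep_sum_power_moments:
  fixes Y :: "'i \<Rightarrow> 'a \<Rightarrow> real" and a b d :: real
  assumes "finite I" and "indep_vars (\<lambda>_. borel) Y I"
    and "\<And>i k. i \<in> I \<Longrightarrow> integrable M (\<lambda>\<omega>. Y i \<omega> ^ k)"
    and "\<And>i. i \<in> I \<Longrightarrow> expectation (Y i) = 0" "\<And>i. i \<in> I \<Longrightarrow> expectation (\<lambda>\<omega>. Y i \<omega> ^ 2) = a"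
      "\<And>i. i \<in> I \<Longrightarrow> expectation (\<lambda>\<omega>. Y i \<omega> ^ 3) = b" "\<And>i. i \<in> I \<Longrightarrow> expectation (\<lambda>\<omega>. Y i \<omega> ^ 4) = d"
  shows "(\<forall>k. integrable M (\<lambda>\<omega>. (\<Sum>i\<in>I. Y i \<omega>) ^ k)) \<and>
    expectation (\<lambda>\<omega>. \<Sum>i\<in>I. Y i \<omega>) = 0 \<and>
    expectation (\<lambda>\<omega>. (\<Sum>i\<in>I. Y i \<omega>) ^ 2) = card I * a \<and>
    expectation (\<lambda>\<omega>. (\<Sum>i\<in>I. Y i \<omega>) ^ 3) = card I * b \<and>
    expectation (\<lambda>\<omega>. (\<Sum>i\<in>I. Y i \<omega>) ^ 4) = card I * d + 3 * real (card I) * (real (card I) - 1) * a\<^sup>2"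
  using assms
proof (induction I)
  case empty
  show ?case by (auto simp: power_0_left)
next
  case (insert j I)
  let ?S = "\<lambda>\<omega>. \<Sum>i\<in>I. Y i \<omega>" and ?y = "Y j"
  have IH: "integrable M (\<lambda>\<omega>. ?S \<omega> ^ k)" "expectation ?S = 0" "expectation (\<lambda>\<omega>. ?S \<omega> ^ 2) = card I * a"
    "expectation (\<lambda>\<omega>. ?S \<omega> ^ 3) = card I * b"
    "expectation (\<lambda>\<omega>. ?S \<omega> ^ 4) = card I * d + 3 * real (card I) * (real (card I) - 1) * a\<^sup>2" for k
    using insert.IH insert.prems indep_vars_subset[OF insert.prems(1), of I] by auto
  have iY: "integrable M (\<lambda>\<omega>. ?y \<omega> ^ k)" for k using insert.prems by auto
  have mY: "expectation ?y = 0" "expectation (\<lambda>\<omega>. ?y \<omega> ^ 2) = a" "expectation (\<lambda>\<omega>. ?y \<omega> ^ 3) = b" "expectation (\<lambda>\<omega>. ?y \<omega> ^ 4) = d"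
    using insert.prems by auto
  have ind: "indep_var borel ?y borel ?S"
    using insert.hyps insert.prems by (intro indep_vars_sum) auto
  have indp: "indep_var borel (\<lambda>\<omega>. ?y \<omega> ^ p) borel (\<lambda>\<omega>. ?S \<omega> ^ q)" for p q
    using indep_var_compose[OF ind, of "\<lambda>z. z ^ p" borel "\<lambda>z. z ^ q" borel] by (simp add: comp_def)
  have int: "integrable M (\<lambda>\<omega>. ?y \<omega> ^ p * ?S \<omega> ^ q)" for p q
    by (rule indep_var_integrable[OF indp iY IH(1)])
  have E: "expectation (\<lambda>\<omega>. ?y \<omega> ^ p * ?S \<omega> ^ q) = expectation (\<lambda>\<omega>. ?y \<omega> ^ p) * expectation (\<lambda>\<omega>. ?S \<omega> ^ q)" for p q
    by (rule indep_var_lebesgue_integral[OF indp iY IH(1)])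
  have iall: "integrable M (\<lambda>\<omega>. (?y \<omega> + ?S \<omega>) ^ k)" for k
    unfolding binomial_ring using int by (auto simp: mult.assoc)
  have ex: "(?y \<omega> + ?S \<omega>) ^ 2 = ?y \<omega> ^ 2 * ?S \<omega> ^ 0 + 2 * (?y \<omega> ^ 1 * ?S \<omega> ^ 1) + ?y \<omega> ^ 0 * ?S \<omega> ^ 2"
    "(?y \<omega> + ?S \<omega>) ^ 3 = ?y \<omega> ^ 3 * ?S \<omega> ^ 0 + 3 * (?y \<omega> ^ 2 * ?S \<omega> ^ 1) + 3 * (?y \<omega> ^ 1 * ?S \<omega> ^ 2) + ?y \<omega> ^ 0 * ?S \<omega> ^ 3"
    "(?y \<omega> + ?S \<omega>) ^ 4 = ?y \<omega> ^ 4 * ?S \<omega> ^ 0 + 4 * (?y \<omega> ^ 3 * ?S \<omega> ^ 1) + 6 * (?y \<omega> ^ 2 * ?S \<omega> ^ 2) + 4 * (?y \<omega> ^ 1 * ?S \<omega> ^ 3) + ?y \<omega> ^ 0 * ?S \<omega> ^ 4" for \<omega>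
    by (simp_all add: power2_eq_square power3_eq_cube power4_eq_xxxx algebra_simps)
  have e1: "expectation (\<lambda>\<omega>. ?y \<omega> + ?S \<omega>) = 0"
    using iY[of 1] IH(1)[of 1] IH(2) mY(1) by simp
  have e2: "expectation (\<lambda>\<omega>. (?y \<omega> + ?S \<omega>) ^ 2) = a + card I * a"
    unfolding ex by (simp only: Bochner_Integration.integral_add Bochner_Integration.integrable_add int
      Bochner_Integration.integral_mult_right Bochner_Integration.integrable_mult_right E) (simp add: IH mY prob_space)
  have e3: "expectation (\<lambda>\<omega>. (?y \<omega> + ?S \<omega>) ^ 3) = b + card I * b"
    unfolding ex by (simp only: Bochner_Integration.integral_add Bochner_Integration.integrable_add int
      Bochner_Integration.integral_mult_right Bochner_Integration.integrable_mult_right E) (simp add: IH mY prob_space)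
  have e4: "expectation (\<lambda>\<omega>. (?y \<omega> + ?S \<omega>) ^ 4) = d + 6 * (a * (card I * a)) + (card I * d + 3 * real (card I) * (real (card I) - 1) * a\<^sup>2)"
    unfolding ex by (simp only: Bochner_Integration.integral_add Bochner_Integration.integrable_add int
      Bochner_Integration.integral_mult_right Bochner_Integration.integrable_mult_right E) (simp add: IH mY prob_space)
  show ?case
    using insert.hyps iall by (simp add: e1 e2 e3 e4) (simp add: algebra_simps power2_eq_square)
qed

text \<open>
  The centred squared norm is a sum of independent copies of \<open>z\<^sup>2 - 1\<close>, whose moments of orders 2, 3
  and 4 under the standard normal law are 2, 8 and 60.
\<close>

lemma gauss_vnorm_sq_central_moments:
  assumes "n \<ge> 1"
  shows "integrable (gauss n) (\<lambda>x. ((vnorm n x)\<^sup>2 - n) ^ k)"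
    "(\<integral>x. ((vnorm n x)\<^sup>2 - n) \<partial>gauss n) = 0"
    "(\<integral>x. ((vnorm n x)\<^sup>2 - n) ^ 2 \<partial>gauss n) = 2 * n"
    "(\<integral>x. ((vnorm n x)\<^sup>2 - n) ^ 3 \<partial>gauss n) = 8 * n"
    "(\<integral>x. ((vnorm n x)\<^sup>2 - n) ^ 4 \<partial>gauss n) = 12 * (real n)\<^sup>2 + 48 * n"
proof -
  interpret prob_space "gauss n" by (rule prob_space_gauss)
  have coord: "(\<integral>x. f (x i) \<partial>gauss n) = (\<integral>z. f z \<partial>std_normal_distribution)"
    "integrable (gauss n) (\<lambda>x. f (x i)) \<longleftrightarrow> integrable std_normal_distribution f"
    if [measurable]: "f \<in> borel_measurable borel" and "i < n" for f :: "real \<Rightarrow> real" and i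
    unfolding gauss_indep_coordinates(2)[OF assms \<open>i < n\<close>, symmetric]
    using \<open>i < n\<close> by (simp_all add: integral_distr integrable_distr_eq)
  interpret N: prob_space std_normal_distribution by (rule prob_space_normal_density) simp
  have pN: "N.prob UNIV = 1" using N.prob_space by simp
  have intN: "integrable std_normal_distribution (\<lambda>z. z ^ j)" for j
    by (rule integrable_std_normal_distribution_moment)
  have intN2: "integrable std_normal_distribution (\<lambda>z. (z\<^sup>2 - 1) ^ j)" for j
  proof -
    have "(\<lambda>z::real. (z\<^sup>2 - 1) ^ j) = (\<lambda>z. \<Sum>k\<le>j. of_nat (j choose k) * z ^ (2 * k) * (-1) ^ (j - k))"
      using binomial_ring[of _ "-1::real" j] by (auto simp: power_mult)
    then show ?thesis using intN by simp
  qed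
  have mom: "(\<integral>z. z ^ 2 \<partial>std_normal_distribution) = 1" "(\<integral>z. z ^ 4 \<partial>std_normal_distribution) = 3"
    "(\<integral>z. z ^ 6 \<partial>std_normal_distribution) = 15" "(\<integral>z. z ^ 8 \<partial>std_normal_distribution) = 105"
    using std_normal_distribution_even_moments(1)[of 1] std_normal_distribution_even_moments(1)[of 2]
      std_normal_distribution_even_moments(1)[of 3] std_normal_distribution_even_moments(1)[of 4]
    by (simp_all add: fact_numeral)
  have N1: "N.expectation (\<lambda>z. z\<^sup>2 - 1) = 0"
    using intN by (simp add: mom pN)
  have N2: "N.expectation (\<lambda>z. (z\<^sup>2 - 1)\<^sup>2) = 2"
  proof -
    have "(\<lambda>z::real. (z\<^sup>2 - 1)\<^sup>2) = (\<lambda>z. z ^ 4 - 2 * z ^ 2 + 1)"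
      by (auto simp: power2_eq_square power4_eq_xxxx algebra_simps)
    then show ?thesis using intN by (simp add: mom pN)
  qed
  have N3: "N.expectation (\<lambda>z. (z\<^sup>2 - 1) ^ 3) = 8"
  proof -
    have "(\<lambda>z::real. (z\<^sup>2 - 1) ^ 3) = (\<lambda>z. z ^ 6 - 3 * z ^ 4 + 3 * z ^ 2 - 1)"
      by (auto simp: eval_nat_numeral algebra_simps)
    then show ?thesis using intN by (simp add: mom pN)
  qed
  have N4: "N.expectation (\<lambda>z. (z\<^sup>2 - 1) ^ 4) = 60"
  proof -
    have "(\<lambda>z::real. (z\<^sup>2 - 1) ^ 4) = (\<lambda>z. z ^ 8 - 4 * z ^ 6 + 6 * z ^ 4 - 4 * z ^ 2 + 1)"
      by (auto simp: eval_nat_numeral algebra_simps)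
    then show ?thesis using intN by (simp add: mom pN)
  qed
  have iv: "indep_vars (\<lambda>_. borel) (\<lambda>i x. (x i)\<^sup>2 - 1) {..<n}"
    using indep_vars_compose2[OF gauss_indep_coordinates(1)[OF assms], of "\<lambda>i z. z\<^sup>2 - 1" "\<lambda>_. borel"] by simp
  have S: "(\<Sum>i<n. (x i)\<^sup>2 - 1) = (vnorm n x)\<^sup>2 - n" for x
    by (simp add: vnorm_sq sum_subtractf)
  have *: "(\<forall>k. integrable (gauss n) (\<lambda>x. (\<Sum>i<n. (x i)\<^sup>2 - 1) ^ k)) \<and>
    expectation (\<lambda>x. \<Sum>i<n. (x i)\<^sup>2 - 1) = 0 \<and>
    expectation (\<lambda>x. (\<Sum>i<n. (x i)\<^sup>2 - 1) ^ 2) = real (card {..<n}) * 2 \<and>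
    expectation (\<lambda>x. (\<Sum>i<n. (x i)\<^sup>2 - 1) ^ 3) = real (card {..<n}) * 8 \<and>
    expectation (\<lambda>x. (\<Sum>i<n. (x i)\<^sup>2 - 1) ^ 4) = real (card {..<n}) * 60 + 3 * real (card {..<n}) * (real (card {..<n}) - 1) * 2\<^sup>2"
    by (rule indep_sum_power_moments[OF _ iv])
       (use intN2 N1 N2 N3 N4 in \<open>simp_all add: coord(1)[of "\<lambda>z. z\<^sup>2 - 1"] coord(1)[of "\<lambda>z. (z\<^sup>2 - 1) ^ _"] coord(2)[of "\<lambda>z. (z\<^sup>2 - 1) ^ _"]\<close>)
  show "integrable (gauss n) (\<lambda>x. ((vnorm n x)\<^sup>2 - n) ^ k)"
    "(\<integral>x. ((vnorm n x)\<^sup>2 - n) \<partial>gauss n) = 0"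
    "(\<integral>x. ((vnorm n x)\<^sup>2 - n) ^ 2 \<partial>gauss n) = 2 * n"
    "(\<integral>x. ((vnorm n x)\<^sup>2 - n) ^ 3 \<partial>gauss n) = 8 * n"
    "(\<integral>x. ((vnorm n x)\<^sup>2 - n) ^ 4 \<partial>gauss n) = 12 * (real n)\<^sup>2 + 48 * n"
    using * unfolding S by (auto simp: algebra_simps power2_eq_square)
qed

lemma integrable_gauss_vnorm_power:
  assumes "n \<ge> 1"
  shows "integrable (gauss n) (\<lambda>x. vnorm n x ^ k)"
proof -
  interpret prob_space "gauss n" by (rule prob_space_gauss)
  have "integrable (gauss n) (\<lambda>x. ((vnorm n x)\<^sup>2) ^ k)"
  proof -
    have "(\<lambda>x. ((vnorm n x)\<^sup>2) ^ k) = (\<lambda>x. \<Sum>j\<le>k. of_nat (k choose j) * ((vnorm n x)\<^sup>2 - n) ^ j * real n ^ (k - j))"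
      using binomial_ring[of "(vnorm n _)\<^sup>2 - real n" "real n" k] by auto
    then show ?thesis using gauss_vnorm_sq_central_moments(1)[OF assms] by simp
  qed
  then have "integrable (gauss n) (\<lambda>x. 1 + ((vnorm n x)\<^sup>2) ^ k)" by simp
  then show ?thesis
  proof (rule Bochner_Integration.integrable_bound)
    have "vnorm n x ^ k \<le> 1 + ((vnorm n x)\<^sup>2) ^ k" for x
    proof -
      have "0 \<le> (vnorm n x ^ k - 1)\<^sup>2 + vnorm n x ^ k" by simp
      then have "2 * vnorm n x ^ k \<le> 1 + (vnorm n x ^ k)\<^sup>2 + vnorm n x ^ k"
        by (simp add: power2_eq_square algebra_simps)
      then show ?thesis by (simp add: power_mult[symmetric] mult.commute)
    qed
    then show "AE x in gauss n. norm (vnorm n x ^ k) \<le> norm (1 + (vnorm n x)\<^sup>2 ^ k)" by simp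
  qed simp
qed

lemma gauss_mean_vnorm_power_pos:
  assumes "n \<ge> 1"
  shows "(\<integral>y. vnorm n y ^ k \<partial>gauss n) > 0"
proof -
  interpret prob_space "gauss n" by (rule prob_space_gauss)
  have "AE x in gauss n. 0 < vnorm n x"
    by (rule AE_gauss_if_AE_Rn[OF AE_vnorm_pos[OF assms]])
  then have pos: "AE x in gauss n. 0 < vnorm n x ^ k" by eventually_elim simp
  have ne: "\<not> (AE x in gauss n. vnorm n x ^ k = 0)"
  proof
    assume "AE x in gauss n. vnorm n x ^ k = 0"
    with pos have "AE x in gauss n. False" by eventually_elim simp
    then show False by simp
  qed
  have "(\<integral>y. vnorm n y ^ k \<partial>gauss n) \<noteq> 0"
    using ne integrable_gauss_vnorm_power[OF assms, of k] by (subst integral_nonneg_eq_0_iff_AE) auto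
  then show ?thesis by (simp add: less_le)
qed

text \<open>
  Valid on the whole domain \<open>u \<ge> -1\<close>, so that no truncation is needed when \<open>u\<close> is random.
\<close>

lemma sqrt_Taylor_bounds:
  fixes u :: real
  assumes "u \<ge> -1"
  shows "sqrt (1 + u) \<le> 1 + u / 2 - u\<^sup>2 / 8 + u ^ 3 / 16"
    and "1 + u / 2 - u\<^sup>2 / 8 + u ^ 3 / 16 - 5 / 16 * u ^ 4 \<le> sqrt (1 + u)"
proof -
  define y where "y = sqrt (1 + u)"
  have y: "y \<ge> 0" "u = y\<^sup>2 - 1" using assms by (auto simp: y_def)
  \<comment> \<open>In terms of \<open>y\<close> the remainder is a polynomial divisible by \<open>(y - 1) ^ 4\<close>, and \<open>u ^ 4 = (y - 1) ^ 4 * (y + 1) ^ 4\<close>.\<close>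
  have eq: "1 + u / 2 - u\<^sup>2 / 8 + u ^ 3 / 16 - y = (y - 1) ^ 4 * (y\<^sup>2 + 4 * y + 5) / 16"
    unfolding y(2) by (simp add: field_simps eval_nat_numeral)
  have "0 \<le> (y - 1) ^ 4 * (y\<^sup>2 + 4 * y + 5) / 16" using y(1) by simp
  with eq show "sqrt (1 + u) \<le> 1 + u / 2 - u\<^sup>2 / 8 + u ^ 3 / 16" by (simp add: y_def)
  have "y\<^sup>2 + 4 * y + 5 \<le> 5 * (1 + y) ^ 4"
    using y(1) by (simp add: eval_nat_numeral algebra_simps)
  then have "(y - 1) ^ 4 * (y\<^sup>2 + 4 * y + 5) \<le> (y - 1) ^ 4 * (5 * (1 + y) ^ 4)"
    by (intro mult_left_mono) auto
  also have "\<dots> = 5 * u ^ 4"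
    unfolding y(2) by (simp add: eval_nat_numeral algebra_simps)
  finally show "1 + u / 2 - u\<^sup>2 / 8 + u ^ 3 / 16 - 5 / 16 * u ^ 4 \<le> sqrt (1 + u)"
    using eq by (simp add: y_def)
qed

text \<open>
  Cruder than \<open>sqrt_Taylor_bounds\<close>, but involving second moments only; it keeps the mean norm away
  from zero in every dimension \<open>n \<ge> 2\<close>.
\<close>

lemma sqrt_ge_quadratic:
  fixes u :: real
  assumes "u \<ge> -1"
  shows "1 + u / 2 - u\<^sup>2 / 2 \<le> sqrt (1 + u)"
proof -
  define y where "y = sqrt (1 + u)"
  have y: "y \<ge> 0" "u = y\<^sup>2 - 1" using assms by (auto simp: y_def)
  have "y - (1 + u / 2 - u\<^sup>2 / 2) = y * (y - 1)\<^sup>2 * (y + 2) / 2"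
    unfolding y(2) by (simp add: field_simps eval_nat_numeral)
  moreover have "y * (y - 1)\<^sup>2 * (y + 2) / 2 \<ge> 0" using y(1) by simp
  ultimately show ?thesis by (simp add: y_def)
qed

text \<open>
  Expand \<open>|G| / sqrt n = sqrt (1 + U)\<close> with \<open>U = (|G|\<^sup>2 - n) / n\<close>. The variance \<open>2 / n\<close> of \<open>U\<close> produces
  the term \<open>- 1 / (4 n)\<close>; the third and fourth moments are of order \<open>1 / n\<^sup>2\<close>.
\<close>

lemma gauss_mean_vnorm_asymp:
  assumes "n \<ge> 2"
  shows "\<bar>(\<integral>x. vnorm n x \<partial>gauss n) / sqrt n - (1 - 1 / (4 * real n))\<bar> \<le> 12 / (real n)\<^sup>2"
    and "1 / 2 \<le> (\<integral>x. vnorm n x \<partial>gauss n) / sqrt n"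
proof -
  interpret prob_space "gauss n" by (rule prob_space_gauss)
  have n1: "n \<ge> 1" and npos: "real n > 0" using assms by auto
  define U where "U x = ((vnorm n x)\<^sup>2 - n) / n" for x
  have Um1: "U x \<ge> -1" for x using npos by (simp add: U_def field_simps)
  have sq: "vnorm n x / sqrt n = sqrt (1 + U x)" for x
    using npos by (simp add: U_def field_simps real_sqrt_divide)
  have Up: "U x ^ k = ((vnorm n x)\<^sup>2 - n) ^ k / real n ^ k" for x k
    by (simp add: U_def power_divide)
  have iU: "integrable (gauss n) (\<lambda>x. U x ^ k)" for k
    unfolding Up using gauss_vnorm_sq_central_moments(1)[OF n1] by simp
  have iU1: "integrable (gauss n) U" using iU[of 1] by simp
  have EU: "expectation U = 0" "expectation (\<lambda>x. U x ^ 2) = 2 / n" "expectation (\<lambda>x. U x ^ 3) = 8 / n ^ 2"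
    "expectation (\<lambda>x. U x ^ 4) = 12 / n ^ 2 + 48 / n ^ 3"
    using gauss_vnorm_sq_central_moments[OF n1] npos
    by (simp_all add: U_def[abs_def] power_divide) (simp_all add: field_simps eval_nat_numeral)
  have iv: "integrable (gauss n) (\<lambda>x. vnorm n x / sqrt n)"
    using integrable_gauss_vnorm_power[OF n1, of 1] by simp
  define w where "w = (\<integral>x. vnorm n x \<partial>gauss n) / sqrt n"
  have w: "w = expectation (\<lambda>x. vnorm n x / sqrt n)" by (simp add: w_def)
  have up: "w \<le> 1 - 1 / (4 * n) + 1 / (2 * n ^ 2)"
  proof -
    have "w \<le> expectation (\<lambda>x. 1 + U x / 2 - (U x)\<^sup>2 / 8 + U x ^ 3 / 16)"
      unfolding w using iv iU iU1 sqrt_Taylor_bounds(1)[OF Um1]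
      by (intro integral_mono) (auto simp: sq)
    also have "\<dots> = 1 - 1 / (4 * n) + 1 / (2 * n ^ 2)"
      using iU iU1 by (simp add: EU prob_space del: space_gauss)
    finally show ?thesis .
  qed
  have lo: "w \<ge> 1 - 1 / (4 * n) + 1 / (2 * n ^ 2) - 5 / 16 * (12 / n ^ 2 + 48 / n ^ 3)"
  proof -
    have "1 - 1 / (4 * n) + 1 / (2 * n ^ 2) - 5 / 16 * (12 / n ^ 2 + 48 / n ^ 3)
       = expectation (\<lambda>x. 1 + U x / 2 - (U x)\<^sup>2 / 8 + U x ^ 3 / 16 - 5 / 16 * U x ^ 4)"
      using iU iU1 by (simp add: EU prob_space del: space_gauss)
    also have "\<dots> \<le> w"
      unfolding w using iv iU iU1 sqrt_Taylor_bounds(2)[OF Um1]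
      by (intro integral_mono) (auto simp: sq)
    finally show ?thesis .
  qed
  \<comment> \<open>The remainder term is at most \<open>5/16 * 36 / n\<^sup>2\<close>, because \<open>48 / n ^ 3 \<le> 24 / n\<^sup>2\<close>.\<close>
  define A B where "A = 1 / real n ^ 2" and "B = 1 / real n ^ 3"
  have "B \<le> A / 2" "A \<ge> 0" using assms by (simp_all add: A_def B_def field_simps eval_nat_numeral)
  moreover have "w \<le> 1 - 1 / (4 * real n) + A / 2" using up by (simp add: A_def)
  moreover have "1 - 1 / (4 * real n) + A / 2 - (15 / 4 * A + 15 * B) \<le> w"
    using lo by (simp add: A_def B_def add_divide_distrib diff_divide_distrib)
  ultimately have "\<bar>w - (1 - 1 / (4 * real n))\<bar> \<le> 12 * A" by linarith
  then show "\<bar>(\<integral>x. vnorm n x \<partial>gauss n) / sqrt n - (1 - 1 / (4 * real n))\<bar> \<le> 12 / (real n)\<^sup>2"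
    by (simp add: w_def A_def)
  have "1 - 1 / n = expectation (\<lambda>x. 1 + U x / 2 - (U x)\<^sup>2 / 2)"
    using iU iU1 by (simp add: EU prob_space del: space_gauss)
  also have "\<dots> \<le> w"
    unfolding w using iv iU iU1 sqrt_ge_quadratic[OF Um1]
    by (intro integral_mono) (auto simp: sq)
  finally have "1 - 1 / real n \<le> w" .
  moreover have "1 / real n \<le> 1 / 2" using assms by (simp add: field_simps)
  ultimately show "1 / 2 \<le> (\<integral>x. vnorm n x \<partial>gauss n) / sqrt n"
    unfolding w_def[symmetric] by linarith
qed

section \<open>Projections of a uniform direction\<close>

lemma AE_sphere_vnorm:
  assumes "n \<ge> 1"
  shows "AE \<theta> in unif_sphere n. vnorm n \<theta> = 1"
proof -
  have "AE x in Rn n. vnorm n (radial n x) = 1"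
    using AE_vnorm_pos[OF assms]
  proof eventually_elim
    case (elim x)
    have "vnorm n (radial n x) = vnorm n (\<lambda>i. (1 / vnorm n x) * x i)"
      by (intro vnorm_cong) (simp add: radial_def)
    also have "\<dots> = 1" using elim by (subst vnorm_scale) auto
    finally show ?case .
  qed
  then have "AE x in gauss n. vnorm n (radial n x) = 1"
    by (rule AE_gauss_if_AE_Rn)
  then show ?thesis
    unfolding distr_gauss_radial[OF assms, symmetric] by (subst AE_distr_iff) auto
qed

lemma integrable_sphere_bounded:
  fixes f :: "(nat \<Rightarrow> real) \<Rightarrow> real"
  assumes "n \<ge> 1" and "f \<in> borel_measurable (Rn n)" and "\<And>\<theta>. vnorm n \<theta> = 1 \<Longrightarrow> \<bar>f \<theta>\<bar> \<le> B"
  shows "integrable (unif_sphere n) f"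
proof -
  interpret prob_space "unif_sphere n" by (rule prob_space_unif_sphere)
  have "AE \<theta> in unif_sphere n. norm (f \<theta>) \<le> B"
    using AE_sphere_vnorm[OF assms(1)] by eventually_elim (use assms(3) in auto)
  then show ?thesis using assms(2) by (intro integrable_const_bound) auto
qed

lemma integrable_sphere_continuous_vinner:
  fixes f :: "real \<Rightarrow> real"
  assumes "n \<ge> 1" and f: "continuous_on UNIV f"
  shows "integrable (unif_sphere n) (\<lambda>\<theta>. f (vinner n x \<theta>))"
proof -
  have [measurable]: "f \<in> borel_measurable borel" using f by (rule borel_measurable_continuous_onI)
  have "compact (f ` cball 0 (vnorm n x))"
    using f by (intro compact_continuous_image) (auto intro: continuous_on_subset)
  then obtain B where B: "\<forall>z\<in>cball 0 (vnorm n x). \<bar>f z\<bar> \<le> B"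
    by (auto dest!: compact_imp_bounded simp: bounded_iff)
  show ?thesis
  proof (rule integrable_sphere_bounded[OF assms(1), of _ B])
    fix \<theta> :: "nat \<Rightarrow> real" assume "vnorm n \<theta> = 1"
    then have "vinner n x \<theta> \<in> cball 0 (vnorm n x)" using abs_vinner_le[of n x \<theta>] by simp
    then show "\<bar>f (vinner n x \<theta>)\<bar> \<le> B" using B by blast
  qed measurable
qed

text \<open>
  The \<open>k\<close>-th power of a projection is homogeneous of degree \<open>k\<close>, and the projection of a Gaussian
  vector on \<open>x\<close> is normal with standard deviation \<open>|x|\<close>.
\<close>

lemma sphere_vinner_power_gauss:
  assumes "n \<ge> 1"
  shows "(\<integral>\<theta>. vinner n x \<theta> ^ k \<partial>unif_sphere n) * (\<integral>y. vnorm n y ^ k \<partial>gauss n)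
     = vnorm n x ^ k * (\<integral>z. z ^ k \<partial>std_normal_distribution)"
proof -
  have "(\<integral>\<theta>. vinner n x \<theta> ^ k \<partial>unif_sphere n) * (\<integral>y. vnorm n y ^ k \<partial>gauss n) = (\<integral>y. vinner n x y ^ k \<partial>gauss n)"
    using assms integrable_gauss_vnorm_power[OF assms]
    by (intro gauss_integral_homogeneous[symmetric] integrable_sphere_continuous_vinner[where f="\<lambda>z. z ^ k"])
       (auto intro!: continuous_intros, metis vinner_radial power_mult_distrib)
  also have "\<dots> = (\<integral>z. (vnorm n x * z) ^ k \<partial>std_normal_distribution)"
    by (rule gauss_vinner_integral[OF assms]) simp
  finally show ?thesis by (simp add: power_mult_distrib)
qed

text \<open>
  The constant \<open>\<kappa>\<close> with \<open>E\<^sub>\<theta> |<x,\<theta>>| = \<kappa> |x|\<close>; see \<open>sphere_moments\<close>.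
\<close>

definition sphere_abs_mean :: "nat \<Rightarrow> real" where
  "sphere_abs_mean n = sqrt (2 / pi) / (\<integral>x. vnorm n x \<partial>gauss n)"

lemma sphere_abs_mean_nonneg: "0 \<le> sphere_abs_mean n"
  by (simp add: sphere_abs_mean_def integral_nonneg_AE)

lemma sphere_abs_mean_asymp:
  assumes "n \<ge> 2"
  shows "\<bar>sphere_abs_mean n * sqrt (pi * n / 2) - (1 + 1 / (4 * real n))\<bar> \<le> 28 / (real n)\<^sup>2"
proof -
  define w where "w = (\<integral>x. vnorm n x \<partial>gauss n) / sqrt n"
  note w = gauss_mean_vnorm_asymp[OF assms, folded w_def]
  have npos: "real n > 0" using assms by auto
  define E where "E = (\<integral>x. vnorm n x \<partial>gauss n)"
  have "E = w * sqrt n" using npos by (simp add: w_def E_def)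
  then have "E > 0" using w(2) npos by simp
  then have k: "sphere_abs_mean n * sqrt (pi * n / 2) = 1 / w"
    using npos by (simp add: sphere_abs_mean_def w_def E_def[symmetric] real_sqrt_divide real_sqrt_mult field_simps)
  define a where "a = 1 / (4 * real n)"
  have a: "0 \<le> a" "a \<le> 1 / 8" "a\<^sup>2 = 1 / (16 * (real n)\<^sup>2)" using assms by (auto simp: a_def field_simps power2_eq_square)
  \<comment> \<open>With \<open>w = 1 - a + O(1 / n\<^sup>2)\<close> one has \<open>w (1 + a) = 1 - a\<^sup>2 + O(1 / n\<^sup>2)\<close>; the constant is \<open>2 (1/16 + 12 * 9/8) < 28\<close>.\<close>
  have "\<bar>1 / w - (1 + a)\<bar> = \<bar>1 - w * (1 + a)\<bar> / w"
    using w(2) by (auto simp: field_simps abs_if)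
  also have "\<dots> \<le> \<bar>1 - w * (1 + a)\<bar> * 2"
    using w(2) divide_left_mono[of "1 / 2" w "\<bar>1 - w * (1 + a)\<bar>"] by simp
  also have "1 - w * (1 + a) = a\<^sup>2 - (w - (1 - a)) * (1 + a)"
    by (simp add: algebra_simps power2_eq_square)
  also have "\<bar>\<dots>\<bar> \<le> a\<^sup>2 + \<bar>w - (1 - a)\<bar> * (1 + a)"
    using a by (intro order_trans[OF abs_triangle_ineq4]) (simp add: abs_mult)
  also have "\<dots> \<le> a\<^sup>2 + (12 / (real n)\<^sup>2) * (1 + 1 / 8)"
    using w(1) a unfolding a_def[symmetric] by (intro add_left_mono mult_mono) auto
  also have "(a\<^sup>2 + (12 / (real n)\<^sup>2) * (1 + 1 / 8)) * 2 \<le> 28 / (real n)\<^sup>2"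
    using npos by (simp add: a field_simps)
  finally show ?thesis unfolding k a_def by simp
qed

lemma sphere_moments:
  assumes "n \<ge> 1"
  shows "odd k \<Longrightarrow> (\<integral>\<theta>. vinner n x \<theta> ^ k \<partial>unif_sphere n) = 0"
    and "(\<integral>\<theta>. (vinner n x \<theta>)\<^sup>2 \<partial>unif_sphere n) = (vnorm n x)\<^sup>2 / n"
    and "(\<integral>\<theta>. (vinner n x \<theta>) ^ 4 \<partial>unif_sphere n) = 3 * vnorm n x ^ 4 / (real n * (real n + 2))"
    and "(\<integral>\<theta>. \<bar>vinner n x \<theta>\<bar> \<partial>unif_sphere n) = sphere_abs_mean n * vnorm n x"
proof -
  interpret prob_space "gauss n" by (rule prob_space_gauss)
  show "odd k \<Longrightarrow> (\<integral>\<theta>. vinner n x \<theta> ^ k \<partial>unif_sphere n) = 0"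
    using sphere_vinner_power_gauss[OF assms, of x k] gauss_mean_vnorm_power_pos[OF assms, of k]
    by (simp add: integral_std_normal_distribution_moment_odd)
  have npos: "real n > 0" using assms by simp
  have i2: "integrable (gauss n) (\<lambda>x. (vnorm n x)\<^sup>2)" "integrable (gauss n) (\<lambda>x. vnorm n x ^ 4)"
    by (rule integrable_gauss_vnorm_power[OF assms])+
  have pr: "prob (space (Rn n)) = 1" using prob_space by simp
  have m2: "(\<integral>x. (vnorm n x)\<^sup>2 \<partial>gauss n) = n"
    using gauss_vnorm_sq_central_moments(2)[OF assms] i2 by (simp add: pr)
  have m4: "(\<integral>x. vnorm n x ^ 4 \<partial>gauss n) = n * (n + 2)"
  proof -
    have "((vnorm n x)\<^sup>2 - n)\<^sup>2 = vnorm n x ^ 4 - 2 * n * (vnorm n x)\<^sup>2 + (real n)\<^sup>2" for x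
      by (simp add: power2_eq_square power4_eq_xxxx algebra_simps)
    then show ?thesis
      using gauss_vnorm_sq_central_moments(3)[OF assms] i2 m2 by (simp add: pr) (simp add: power2_eq_square algebra_simps)
  qed
  have "(\<integral>z. z ^ 2 \<partial>std_normal_distribution) = 1"
    using std_normal_distribution_even_moments(1)[of 1] by (simp add: fact_numeral)
  then show "(\<integral>\<theta>. (vinner n x \<theta>)\<^sup>2 \<partial>unif_sphere n) = (vnorm n x)\<^sup>2 / n"
    using sphere_vinner_power_gauss[OF assms, of x 2] npos by (simp add: m2 field_simps)
  have "(\<integral>z. z ^ 4 \<partial>std_normal_distribution) = 3"
    using std_normal_distribution_even_moments(1)[of 2] by (simp add: fact_numeral)
  then show "(\<integral>\<theta>. (vinner n x \<theta>) ^ 4 \<partial>unif_sphere n) = 3 * vnorm n x ^ 4 / (real n * (real n + 2))"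
    using sphere_vinner_power_gauss[OF assms, of x 4] npos
      nonzero_eq_divide_eq[of "real n * (real n + 2)" _ "3 * vnorm n x ^ 4"]
    by (simp add: m4) (simp add: algebra_simps)
  have "(\<integral>\<theta>. \<bar>vinner n x \<theta>\<bar> \<partial>unif_sphere n) * (\<integral>y. vnorm n y ^ 1 \<partial>gauss n) = (\<integral>y. \<bar>vinner n x y\<bar> \<partial>gauss n)"
    using assms integrable_gauss_vnorm_power[OF assms, of 1]
    by (intro gauss_integral_homogeneous[symmetric] integrable_sphere_continuous_vinner[where f="\<lambda>z. \<bar>z\<bar>"])
       (auto intro!: continuous_intros, metis vinner_radial abs_mult abs_of_nonneg vnorm_nonneg)
  also have "\<dots> = (\<integral>z. \<bar>vnorm n x * z\<bar> \<partial>std_normal_distribution)"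
    by (rule gauss_vinner_integral[OF assms]) simp
  also have "\<dots> = vnorm n x * sqrt (2 / pi)"
    using std_normal_distribution_odd_moments_abs[of 0] by (simp add: abs_mult)
  finally show "(\<integral>\<theta>. \<bar>vinner n x \<theta>\<bar> \<partial>unif_sphere n) = sphere_abs_mean n * vnorm n x"
    using gauss_mean_vnorm_power_pos[OF assms, of 1] by (simp add: sphere_abs_mean_def field_simps)
qed

text \<open>
  Rotation invariance in terms of one-dimensional projections: the law of \<open><x,\<theta>>\<close>
  depends on \<open>|x|\<close> alone. All moments do, and continuous functions on the bounded range of the
  projection are uniform limits of polynomials.
\<close>

lemma sphere_integral_vinner_cong:
  fixes f :: "real \<Rightarrow> real"
  assumes "n \<ge> 1" and f: "continuous_on UNIV f" and xy: "vnorm n x = vnorm n y"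
  shows "(\<integral>\<theta>. f (vinner n x \<theta>) \<partial>unif_sphere n) = (\<integral>\<theta>. f (vinner n y \<theta>) \<partial>unif_sphere n)"
proof -
  interpret prob_space "unif_sphere n" by (rule prob_space_unif_sphere)
  have pow: "(\<integral>\<theta>. vinner n x \<theta> ^ k \<partial>unif_sphere n) = (\<integral>\<theta>. vinner n y \<theta> ^ k \<partial>unif_sphere n)" for k
  proof -
    let ?c = "\<integral>y. vnorm n y ^ k \<partial>gauss n"
    have "(\<integral>\<theta>. vinner n x \<theta> ^ k \<partial>unif_sphere n) * ?c = (\<integral>\<theta>. vinner n y \<theta> ^ k \<partial>unif_sphere n) * ?c"
      using sphere_vinner_power_gauss[OF assms(1), of x k] sphere_vinner_power_gauss[OF assms(1), of y k] xy by simp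
    then show ?thesis using gauss_mean_vnorm_power_pos[OF assms(1), of k]
      unfolding mult_cancel_right by linarith
  qed
  have close: "\<bar>expectation (\<lambda>\<theta>. f (vinner n v \<theta>)) - expectation (\<lambda>\<theta>. g (vinner n v \<theta>))\<bar> \<le> e"
    if g: "continuous_on UNIV g" and fg: "\<And>z. z \<in> cball 0 (vnorm n v) \<Longrightarrow> \<bar>f z - g z\<bar> \<le> e" for g e v
  proof -
    have i: "integrable (unif_sphere n) (\<lambda>\<theta>. f (vinner n v \<theta>) - g (vinner n v \<theta>))"
      using integrable_sphere_continuous_vinner[OF assms(1,2)] integrable_sphere_continuous_vinner[OF assms(1) g] by simp
    have "AE \<theta> in unif_sphere n. \<bar>f (vinner n v \<theta>) - g (vinner n v \<theta>)\<bar> \<le> e"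
      using AE_sphere_vnorm[OF assms(1)]
    proof eventually_elim
      case (elim \<theta>)
      show ?case using abs_vinner_le[of n v \<theta>] elim by (intro fg) auto
    qed
    then have "expectation (\<lambda>\<theta>. \<bar>f (vinner n v \<theta>) - g (vinner n v \<theta>)\<bar>) \<le> expectation (\<lambda>\<theta>. e)"
      using i by (intro integral_mono_AE) auto
    then have "\<bar>expectation (\<lambda>\<theta>. f (vinner n v \<theta>) - g (vinner n v \<theta>))\<bar> \<le> e"
      using prob_space by (intro order_trans[OF integral_abs_bound]) simp
    then show ?thesis
      using integrable_sphere_continuous_vinner[OF assms(1,2)] integrable_sphere_continuous_vinner[OF assms(1) g] by simp
  qed
  show ?thesis
  proof (rule ccontr)
    let ?d = "expectation (\<lambda>\<theta>. f (vinner n x \<theta>)) - expectation (\<lambda>\<theta>. f (vinner n y \<theta>))"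
    assume neq: "expectation (\<lambda>\<theta>. f (vinner n x \<theta>)) \<noteq> expectation (\<lambda>\<theta>. f (vinner n y \<theta>))"
    then have "\<bar>?d\<bar> / 3 > 0" by simp
    then obtain g where g: "real_polynomial_function g"
        and fg: "\<And>z. z \<in> cball 0 (vnorm n x) \<Longrightarrow> \<bar>f z - g z\<bar> < \<bar>?d\<bar> / 3"
      using Stone_Weierstrass_real_polynomial_function[of "cball 0 (vnorm n x)" f "\<bar>?d\<bar> / 3"] f
      by (metis compact_cball continuous_on_subset subset_UNIV)
    obtain a N where geq: "g = (\<lambda>z. \<Sum>i\<le>N. a i * z ^ i)"
      using g real_polynomial_function_iff_sum by blast
    have gc: "continuous_on UNIV g" unfolding geq by (intro continuous_intros)
    have "expectation (\<lambda>\<theta>. g (vinner n v \<theta>)) = (\<Sum>i\<le>N. a i * expectation (\<lambda>\<theta>. vinner n v \<theta> ^ i))" for v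
      unfolding geq using integrable_sphere_continuous_vinner[OF assms(1), of "\<lambda>z. z ^ _" v]
      by (simp add: continuous_intros)
    then have "expectation (\<lambda>\<theta>. g (vinner n x \<theta>)) = expectation (\<lambda>\<theta>. g (vinner n y \<theta>))"
      using pow by simp
    moreover have "\<bar>expectation (\<lambda>\<theta>. f (vinner n x \<theta>)) - expectation (\<lambda>\<theta>. g (vinner n x \<theta>))\<bar> \<le> \<bar>?d\<bar> / 3"
      by (rule close[OF gc]) (use fg in force)
    moreover have "\<bar>expectation (\<lambda>\<theta>. f (vinner n y \<theta>)) - expectation (\<lambda>\<theta>. g (vinner n y \<theta>))\<bar> \<le> \<bar>?d\<bar> / 3"
      by (rule close[OF gc]) (use fg xy in force)
    ultimately show False using neq by (auto simp: abs_if split: if_splits)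
  qed
qed

lemma nn_sphere_vinner_cong:
  assumes "n \<ge> 1" and "vnorm n x = vnorm n y"
  shows "(\<integral>\<^sup>+\<theta>. ennreal \<bar>vinner n x \<theta> - c\<bar> \<partial>unif_sphere n) = (\<integral>\<^sup>+\<theta>. ennreal \<bar>vinner n y \<theta> - c\<bar> \<partial>unif_sphere n)"
proof -
  have c: "continuous_on UNIV (\<lambda>z::real. \<bar>z - c\<bar>)" by (intro continuous_intros)
  show ?thesis
    using sphere_integral_vinner_cong[OF assms(1) c assms(2)] integrable_sphere_continuous_vinner[OF assms(1) c]
    by (simp add: nn_integral_eq_integral)
qed

lemma nn_sphere_abs_vinner:
  assumes "n \<ge> 1"
  shows "(\<integral>\<^sup>+\<theta>. ennreal \<bar>vinner n x \<theta>\<bar> \<partial>unif_sphere n) = ennreal (sphere_abs_mean n * vnorm n x)"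
proof -
  have "continuous_on UNIV (\<lambda>z::real. \<bar>z\<bar>)" by (intro continuous_intros)
  then show ?thesis
    using sphere_moments(4)[OF assms, of x] integrable_sphere_continuous_vinner[OF assms]
    by (subst nn_integral_eq_integral) auto
qed

section \<open>Two independent uniform directions\<close>

definition unit_coord :: "nat \<Rightarrow> real" where
  "unit_coord = (\<lambda>i. if i = 0 then 1 else 0)"

lemma vnorm_unit_coord: "n \<ge> 1 \<Longrightarrow> vnorm n unit_coord = 1"
proof -
  assume "n \<ge> 1"
  have "(\<Sum>i<n. (unit_coord i)\<^sup>2) = (\<Sum>i<n. if i = 0 then 1 else 0)"
    by (intro sum.cong) (auto simp: unit_coord_def)
  also have "\<dots> = 1" using \<open>n \<ge> 1\<close> by (subst sum.delta) auto
  finally show ?thesis by (simp add: vnorm_def L2_set_def)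
qed

text \<open>
  The mean distance of \<open>r \<theta>\<close> and \<open>s \<theta>'\<close> for independent uniform directions, expressed by the
  cosine rule; by rotation invariance \<open>\<theta>'\<close> may be fixed to be the first coordinate vector.
\<close>

definition sphere_pair_mean :: "nat \<Rightarrow> real \<Rightarrow> real \<Rightarrow> real" where
  "sphere_pair_mean n r s = (\<integral>\<theta>. sqrt (r\<^sup>2 + s\<^sup>2 - 2 * r * s * vinner n unit_coord \<theta>) \<partial>unif_sphere n)"

lemma measurable_sphere_pair_mean [measurable (raw)]:
  assumes [measurable]: "f \<in> borel_measurable M" "g \<in> borel_measurable M"
  shows "(\<lambda>p. sphere_pair_mean n (f p) (g p)) \<in> borel_measurable M"
proof -
  interpret S: prob_space "unif_sphere n" by (rule prob_space_unif_sphere)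
  have "vinner n unit_coord \<in> borel_measurable (unif_sphere n)" by measurable
  then have [measurable]: "(\<lambda>p. vinner n unit_coord (snd p)) \<in> borel_measurable (M \<Otimes>\<^sub>M unif_sphere n)"
    by (rule measurable_compose[OF measurable_snd])
  have [measurable]: "(\<lambda>p. f (fst p)) \<in> borel_measurable (M \<Otimes>\<^sub>M unif_sphere n)"
     "(\<lambda>p. g (fst p)) \<in> borel_measurable (M \<Otimes>\<^sub>M unif_sphere n)"
    by (auto intro!: measurable_compose[OF measurable_fst])
  have "(\<lambda>p. sqrt ((f (fst p))\<^sup>2 + (g (fst p))\<^sup>2 - 2 * f (fst p) * g (fst p) * vinner n unit_coord (snd p)))
    \<in> borel_measurable (M \<Otimes>\<^sub>M unif_sphere n)"
    by (intro measurable_compose[OF _ borel_measurable_sqrt] borel_measurable_diff borel_measurable_add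
        borel_measurable_times borel_measurable_power borel_measurable_const) fact+
  then show ?thesis
    unfolding sphere_pair_mean_def
    by (intro S.borel_measurable_lebesgue_integral) (simp add: case_prod_beta')
qed

text \<open>
  Averaging over a third direction \<open>w\<close> converts a mean absolute difference of projections into a
  mean distance between points of two spheres.
\<close>

lemma nn_sphere_pair:
  assumes "n \<ge> 1"
  shows "(\<integral>\<^sup>+\<theta>. \<integral>\<^sup>+\<theta>'. ennreal \<bar>vinner n x \<theta> - vinner n y \<theta>'\<bar> \<partial>unif_sphere n \<partial>unif_sphere n)
    = ennreal (sphere_abs_mean n * sphere_pair_mean n (vnorm n x) (vnorm n y))"
proof -
  let ?S = "unif_sphere n"
  interpret S: prob_space ?S by (rule prob_space_unif_sphere)
  interpret SS: pair_sigma_finite ?S ?S ..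
  have 1: "emeasure ?S (space (Rn n)) = 1" using S.emeasure_space_1 by simp
  define r s where "r = vnorm n x" and "s = vnorm n y"
  let ?A = "\<integral>\<^sup>+\<theta>. \<integral>\<^sup>+\<theta>'. ennreal \<bar>vinner n x \<theta> - vinner n y \<theta>'\<bar> \<partial>?S \<partial>?S"
  \<comment> \<open>Rotating \<open>x\<close> to \<open>|x| w\<close> and \<open>y\<close> to \<open>|y| w\<close> turns the difference of two projections into the projection of a single vector on \<open>w\<close>.\<close>
  have unit: "?A = (\<integral>\<^sup>+\<theta>'. \<integral>\<^sup>+\<theta>. ennreal \<bar>r * vinner n \<theta> w - s * vinner n \<theta>' w\<bar> \<partial>?S \<partial>?S)"
    if w: "vnorm n w = 1" for w
  proof -
    have sc: "vinner n (\<lambda>i. t * w i) \<theta> = t * vinner n \<theta> w" for t \<theta>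
      by (simp add: vinner_def sum_distrib_left mult_ac)
    have "(\<lambda>\<theta>. vinner n \<theta> w) \<in> borel_measurable ?S" "vinner n x \<in> borel_measurable ?S"
      by measurable
    then have m1: "(\<lambda>p. vinner n (snd p) w) \<in> borel_measurable (?S \<Otimes>\<^sub>M ?S)"
      and m2: "(\<lambda>p. vinner n x (fst p)) \<in> borel_measurable (?S \<Otimes>\<^sub>M ?S)"
      by (auto intro: measurable_compose[OF measurable_snd] measurable_compose[OF measurable_fst])
    have nx: "vnorm n x = vnorm n (\<lambda>i. r * w i)" and ny: "vnorm n y = vnorm n (\<lambda>i. s * w i)"
      using w by (simp_all add: r_def s_def vnorm_scale)
    have "?A = (\<integral>\<^sup>+\<theta>. \<integral>\<^sup>+\<theta>'. ennreal \<bar>vinner n y \<theta>' - vinner n x \<theta>\<bar> \<partial>?S \<partial>?S)"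
      by (simp add: abs_minus_commute)
    also have "\<dots> = (\<integral>\<^sup>+\<theta>. \<integral>\<^sup>+\<theta>'. ennreal \<bar>s * vinner n \<theta>' w - vinner n x \<theta>\<bar> \<partial>?S \<partial>?S)"
      unfolding nn_sphere_vinner_cong[OF assms ny] sc ..
    also have "\<dots> = (\<integral>\<^sup>+\<theta>'. \<integral>\<^sup>+\<theta>. ennreal \<bar>s * vinner n \<theta>' w - vinner n x \<theta>\<bar> \<partial>?S \<partial>?S)"
      by (rule SS.Fubini'[symmetric], unfold case_prod_beta) (intro measurable_compose[OF _ measurable_ennreal] borel_measurable_abs
          borel_measurable_diff borel_measurable_times borel_measurable_const m1 m2)
    also have "\<dots> = (\<integral>\<^sup>+\<theta>'. \<integral>\<^sup>+\<theta>. ennreal \<bar>vinner n x \<theta> - s * vinner n \<theta>' w\<bar> \<partial>?S \<partial>?S)"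
      by (simp add: abs_minus_commute)
    also have "\<dots> = (\<integral>\<^sup>+\<theta>'. \<integral>\<^sup>+\<theta>. ennreal \<bar>r * vinner n \<theta> w - s * vinner n \<theta>' w\<bar> \<partial>?S \<partial>?S)"
      unfolding nn_sphere_vinner_cong[OF assms nx] sc ..
    finally show ?thesis .
  qed
  \<comment> \<open>Averaging over \<open>w\<close> and integrating over \<open>w\<close> first leaves the mean length of \<open>r \<theta> - s \<theta>'\<close>.\<close>
  have "?A = (\<integral>\<^sup>+w. ?A \<partial>?S)" using 1 by simp
  also have "\<dots> = (\<integral>\<^sup>+w. \<integral>\<^sup>+\<theta>'. \<integral>\<^sup>+\<theta>. ennreal \<bar>r * vinner n \<theta> w - s * vinner n \<theta>' w\<bar> \<partial>?S \<partial>?S \<partial>?S)"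
    by (intro nn_integral_cong_AE, use AE_sphere_vnorm[OF assms] in eventually_elim) (rule unit)
  also have "\<dots> = (\<integral>\<^sup>+\<theta>'. \<integral>\<^sup>+w. \<integral>\<^sup>+\<theta>. ennreal \<bar>r * vinner n \<theta> w - s * vinner n \<theta>' w\<bar> \<partial>?S \<partial>?S \<partial>?S)"
    by (rule SS.Fubini') measurable
  also have "\<dots> = (\<integral>\<^sup>+\<theta>'. \<integral>\<^sup>+\<theta>. \<integral>\<^sup>+w. ennreal \<bar>r * vinner n \<theta> w - s * vinner n \<theta>' w\<bar> \<partial>?S \<partial>?S \<partial>?S)"
    by (intro nn_integral_cong SS.Fubini') measurable
  also have "\<dots> = (\<integral>\<^sup>+\<theta>'. \<integral>\<^sup>+\<theta>. ennreal (sphere_abs_mean n * vnorm n (\<lambda>i. r * \<theta> i - s * \<theta>' i)) \<partial>?S \<partial>?S)"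
    unfolding vinner_lincomb[symmetric] nn_sphere_abs_vinner[OF assms] ..
  also have "\<dots> = (\<integral>\<^sup>+\<theta>'. ennreal (sphere_abs_mean n * sphere_pair_mean n r s) \<partial>?S)"
  proof (rule nn_integral_cong_AE, use AE_sphere_vnorm[OF assms] in eventually_elim)
    fix \<theta>' :: "nat \<Rightarrow> real" assume u': "vnorm n \<theta>' = 1"
    let ?f = "\<lambda>z. sqrt (r\<^sup>2 + s\<^sup>2 - 2 * r * s * z)"
    have c: "continuous_on UNIV ?f" by (intro continuous_intros)
    have i: "integrable ?S (\<lambda>\<theta>. ?f (vinner n \<theta>' \<theta>))"
      by (rule integrable_sphere_continuous_vinner[OF assms c])
    have k0: "0 \<le> sphere_abs_mean n"
      by (simp add: sphere_abs_mean_def integral_nonneg_AE)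
    have ae: "AE \<theta> in ?S. vnorm n (\<lambda>i. r * \<theta> i - s * \<theta>' i) = ?f (vinner n \<theta>' \<theta>)"
      using AE_sphere_vnorm[OF assms] by eventually_elim (simp add: vnorm_lincomb u' vinner_commute)
    have nn: "AE \<theta> in ?S. 0 \<le> ?f (vinner n \<theta>' \<theta>)"
      using ae by eventually_elim (metis vnorm_nonneg)
    have "(\<integral>\<^sup>+\<theta>. ennreal (sphere_abs_mean n * vnorm n (\<lambda>i. r * \<theta> i - s * \<theta>' i)) \<partial>?S)
      = (\<integral>\<^sup>+\<theta>. ennreal (sphere_abs_mean n * ?f (vinner n \<theta>' \<theta>)) \<partial>?S)"
      by (intro nn_integral_cong_AE, use ae in eventually_elim) simp
    also have "\<dots> = ennreal (\<integral>\<theta>. sphere_abs_mean n * ?f (vinner n \<theta>' \<theta>) \<partial>?S)"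
      using i nn k0 by (intro nn_integral_eq_integral) (auto elim!: eventually_mono)
    also have "(\<integral>\<theta>. sphere_abs_mean n * ?f (vinner n \<theta>' \<theta>) \<partial>?S) = sphere_abs_mean n * sphere_pair_mean n r s"
      using sphere_integral_vinner_cong[OF assms c, of \<theta>' unit_coord] u' vnorm_unit_coord[OF assms]
      by (simp add: sphere_pair_mean_def)
    finally show "(\<integral>\<^sup>+\<theta>. ennreal (sphere_abs_mean n * vnorm n (\<lambda>i. r * \<theta> i - s * \<theta>' i)) \<partial>?S)
      = ennreal (sphere_abs_mean n * sphere_pair_mean n r s)" .
  qed
  also have "\<dots> = ennreal (sphere_abs_mean n * sphere_pair_mean n r s)" using 1 by simp
  finally show ?thesis unfolding r_def s_def .
qed

text \<open>
  Factor out \<open>sqrt q\<close> and expand \<open>sqrt (1 - \<rho> T)\<close> with \<open>T\<close> the projection on a unit vector. The first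
  and third order terms have mean zero, the second order term has mean \<open>- \<rho>\<^sup>2 / (8 n)\<close>, and the
  remainder is at most \<open>5/16 * 3 / (n (n + 2))\<close>.
\<close>

lemma sphere_pair_mean_approx:
  fixes r s :: real
  assumes "n \<ge> 1" "r \<ge> 0" "s \<ge> 0"
  defines "q \<equiv> r\<^sup>2 + s\<^sup>2"
  shows "\<bar>sphere_pair_mean n r s - sqrt q * (1 - (2 * r * s / q)\<^sup>2 / (8 * real n))\<bar> \<le> sqrt q / (real n)\<^sup>2"
proof (cases "q = 0")
  case True
  then have "r = 0" "s = 0" by (auto simp: q_def add_nonneg_eq_0_iff)
  then show ?thesis by (simp add: sphere_pair_mean_def q_def)
next
  case False
  then have q: "q > 0" by (simp add: q_def less_le)
  interpret S: prob_space "unif_sphere n" by (rule prob_space_unif_sphere)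
  define \<rho> where "\<rho> = 2 * r * s / q"
  have "2 * r * s \<le> q" using sum_squares_bound[of r s] by (simp add: q_def)
  then have \<rho>: "0 \<le> \<rho>" "\<rho> \<le> 1" using q assms by (auto simp: \<rho>_def field_simps)
  define T where "T = vinner n unit_coord"
  have iT: "integrable (unif_sphere n) (\<lambda>\<theta>. T \<theta> ^ k)" for k
    unfolding T_def by (rule integrable_sphere_continuous_vinner[OF assms(1), of "\<lambda>z. z ^ k"]) (intro continuous_intros)
  have iT1: "integrable (unif_sphere n) T" using iT[of 1] by simp
  have ET: "S.expectation T = 0" "S.expectation (\<lambda>\<theta>. T \<theta> ^ 2) = 1 / n" "S.expectation (\<lambda>\<theta>. T \<theta> ^ 3) = 0"
    "S.expectation (\<lambda>\<theta>. T \<theta> ^ 4) = 3 / (real n * (real n + 2))"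
    using sphere_moments(1)[OF assms(1), of 1 unit_coord] sphere_moments(1)[OF assms(1), of 3 unit_coord]
      sphere_moments(2,3)[OF assms(1), of unit_coord] vnorm_unit_coord[OF assms(1)]
    by (simp_all add: T_def)
  have pr: "S.prob (space (Rn n)) = 1" using S.prob_space by simp
  have bT: "AE \<theta> in unif_sphere n. \<bar>T \<theta>\<bar> \<le> 1"
    using AE_sphere_vnorm[OF assms(1)]
  proof eventually_elim
    case (elim \<theta>)
    then show ?case
      using abs_vinner_le[of n unit_coord \<theta>] vnorm_unit_coord[OF assms(1)] by (simp add: T_def)
  qed
  have fac: "sqrt (r\<^sup>2 + s\<^sup>2 - 2 * r * s * t) = sqrt q * sqrt (1 + - (\<rho> * t))" for t
    using q by (simp add: \<rho>_def q_def[symmetric] real_sqrt_mult[symmetric] field_simps)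
  define w where "w = S.expectation (\<lambda>\<theta>. sqrt (1 + - (\<rho> * T \<theta>)))"
  have J: "sphere_pair_mean n r s = sqrt q * w"
    unfolding sphere_pair_mean_def fac w_def T_def by simp
  have iw: "integrable (unif_sphere n) (\<lambda>\<theta>. sqrt (1 + - (\<rho> * T \<theta>)))"
    unfolding T_def by (rule integrable_sphere_continuous_vinner[OF assms(1), of "\<lambda>z. sqrt (1 + - (\<rho> * z))"]) (intro continuous_intros)
  have arg: "AE \<theta> in unif_sphere n. - (\<rho> * T \<theta>) \<ge> -1"
    using bT
  proof eventually_elim
    case (elim \<theta>)
    have "\<rho> * T \<theta> \<le> \<bar>\<rho>\<bar> * \<bar>T \<theta>\<bar>" by (simp add: abs_mult[symmetric])
    also have "\<dots> \<le> 1 * 1" using \<rho> elim by (intro mult_mono) auto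
    finally show ?case by simp
  qed
  let ?p = "\<lambda>\<theta>. 1 + - (\<rho> * T \<theta>) / 2 - (- (\<rho> * T \<theta>))\<^sup>2 / 8 + (- (\<rho> * T \<theta>)) ^ 3 / 16"
  have ip: "integrable (unif_sphere n) ?p"
    using iT iT1 by (simp add: power_mult_distrib)
  have Ep: "S.expectation ?p = 1 - \<rho>\<^sup>2 / (8 * n)"
    using iT iT1 by (simp add: power_mult_distrib ET pr)
  have up: "w \<le> 1 - \<rho>\<^sup>2 / (8 * n)"
    unfolding Ep[symmetric] w_def
    by (intro integral_mono_AE iw ip, use arg in eventually_elim) (rule sqrt_Taylor_bounds(1))
  let ?e = "\<lambda>\<theta>. 5 / 16 * (- (\<rho> * T \<theta>)) ^ 4"
  have ie: "integrable (unif_sphere n) ?e" using iT by (simp add: power_mult_distrib)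
  have Ee: "S.expectation ?e = 15 / 16 * \<rho> ^ 4 / (real n * (real n + 2))"
    using iT by (simp add: power_mult_distrib ET)
  have "1 - \<rho>\<^sup>2 / (8 * n) - 15 / 16 * \<rho> ^ 4 / (real n * (real n + 2)) = S.expectation (\<lambda>\<theta>. ?p \<theta> - ?e \<theta>)"
    using ip ie Ep Ee by (simp only: Bochner_Integration.integral_diff)
  also have "\<dots> \<le> w"
    unfolding w_def
    by (intro integral_mono_AE Bochner_Integration.integrable_diff iw ip ie, use arg in eventually_elim)
       (rule sqrt_Taylor_bounds(2))
  finally have lo: "1 - \<rho>\<^sup>2 / (8 * n) - 15 / 16 * \<rho> ^ 4 / (real n * (real n + 2)) \<le> w" .
  have "15 / 16 * \<rho> ^ 4 / (real n * (real n + 2)) \<le> 1 / (real n)\<^sup>2"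
    using \<rho> assms(1) power_le_one[of \<rho> 4] by (intro frac_le) (auto simp: power2_eq_square)
  with up lo have "\<bar>w - (1 - \<rho>\<^sup>2 / (8 * n))\<bar> \<le> 1 / (real n)\<^sup>2" by simp
  then have "sqrt q * \<bar>w - (1 - \<rho>\<^sup>2 / (8 * n))\<bar> \<le> sqrt q * (1 / (real n)\<^sup>2)"
    using q by (intro mult_left_mono) auto
  moreover have "sqrt q * w - sqrt q * (1 - \<rho>\<^sup>2 / (8 * n)) = sqrt q * (w - (1 - \<rho>\<^sup>2 / (8 * n)))"
    by (rule right_diff_distrib[symmetric])
  ultimately show ?thesis
    unfolding \<rho>_def[symmetric] J using q by (simp add: abs_mult)
qed

section \<open>The energy identity\<close>

lemma nn_integral_abs_diff_layers:
  fixes a b :: real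
  shows "(\<integral>\<^sup>+x. (if a \<le> x then 1 else 0) * (if b \<le> x then 0 else 1) + (if b \<le> x then 1 else 0) * (if a \<le> x then 0 else 1) \<partial>lborel)
    = ennreal \<bar>a - b\<bar>"
proof -
  have "(\<integral>\<^sup>+x. (if a \<le> x then 1 else 0) * (if b \<le> x then 0 else 1) + (if b \<le> x then 1 else 0) * (if a \<le> x then 0 else 1) \<partial>lborel)
    = (\<integral>\<^sup>+x. indicator ({a..<b} \<union> {b..<a}) x \<partial>lborel)"
    by (intro nn_integral_cong) (auto simp: indicator_def)
  also have "\<dots> = emeasure lborel ({a..<b} \<union> {b..<a})" by (rule nn_integral_indicator) simp
  also have "\<dots> = ennreal \<bar>a - b\<bar>"
    by (cases "a \<le> b") auto
  finally show ?thesis .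
qed

text \<open>
  Gini's mean difference: write \<open>|a - b|\<close> as the length of the set of \<open>x\<close> separating \<open>a\<close> and \<open>b\<close>, and
  integrate over \<open>x\<close> last. All integrands are nonnegative, so infinite values do no harm.
\<close>

lemma (in prob_space) mean_abs_diff_eq:
  fixes Z :: "'a \<Rightarrow> real"
  assumes [measurable]: "Z \<in> borel_measurable M"
  defines "F \<equiv> \<lambda>x. measure M {\<omega> \<in> space M. Z \<omega> \<le> x}"
  shows "(\<integral>\<^sup>+\<omega>. \<integral>\<^sup>+\<omega>'. ennreal \<bar>Z \<omega> - Z \<omega>'\<bar> \<partial>M \<partial>M) = (\<integral>\<^sup>+x. 2 * ennreal (F x * (1 - F x)) \<partial>lborel)"
proof -
  interpret Q: pair_sigma_finite M lborel ..
  define a b :: "'a \<Rightarrow> real \<Rightarrow> ennreal"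
    where "a = (\<lambda>\<omega> x. if Z \<omega> \<le> x then 1 else 0)" and "b = (\<lambda>\<omega> x. if Z \<omega> \<le> x then 0 else 1)"
  have [measurable]: "(\<lambda>p. a (f p) (g p)) \<in> borel_measurable N" "(\<lambda>p. b (f p) (g p)) \<in> borel_measurable N"
    if [measurable]: "f \<in> N \<rightarrow>\<^sub>M M" "g \<in> borel_measurable N" for f g and N :: "'z measure"
    unfolding a_def b_def by measurable
  have F: "0 \<le> F x" "F x \<le> 1" for x by (auto simp: F_def)
  have ia: "(\<integral>\<^sup>+\<omega>. a \<omega> x \<partial>M) = ennreal (F x)" for x
  proof -
    have "(\<integral>\<^sup>+\<omega>. a \<omega> x \<partial>M) = (\<integral>\<^sup>+\<omega>. indicator {\<omega> \<in> space M. Z \<omega> \<le> x} \<omega> \<partial>M)"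
      by (intro nn_integral_cong) (auto simp: a_def)
    then show ?thesis by (simp add: F_def emeasure_eq_measure)
  qed
  have ib: "(\<integral>\<^sup>+\<omega>. b \<omega> x \<partial>M) = ennreal (1 - F x)" for x
  proof -
    have "(\<integral>\<^sup>+\<omega>. b \<omega> x \<partial>M) = (\<integral>\<^sup>+\<omega>. indicator (space M - {\<omega> \<in> space M. Z \<omega> \<le> x}) \<omega> \<partial>M)"
      by (intro nn_integral_cong) (auto simp: b_def)
    then show ?thesis by (simp add: F_def emeasure_eq_measure prob_compl)
  qed
  have "(\<integral>\<^sup>+\<omega>. \<integral>\<^sup>+\<omega>'. ennreal \<bar>Z \<omega> - Z \<omega>'\<bar> \<partial>M \<partial>M)
    = (\<integral>\<^sup>+\<omega>. \<integral>\<^sup>+\<omega>'. \<integral>\<^sup>+x. a \<omega> x * b \<omega>' x + a \<omega>' x * b \<omega> x \<partial>lborel \<partial>M \<partial>M)"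
    unfolding a_def b_def nn_integral_abs_diff_layers ..
  also have "\<dots> = (\<integral>\<^sup>+\<omega>. \<integral>\<^sup>+x. \<integral>\<^sup>+\<omega>'. a \<omega> x * b \<omega>' x + a \<omega>' x * b \<omega> x \<partial>M \<partial>lborel \<partial>M)"
    by (intro nn_integral_cong Q.Fubini'[symmetric]) measurable
  also have "\<dots> = (\<integral>\<^sup>+x. \<integral>\<^sup>+\<omega>. \<integral>\<^sup>+\<omega>'. a \<omega> x * b \<omega>' x + a \<omega>' x * b \<omega> x \<partial>M \<partial>M \<partial>lborel)"
    by (intro Q.Fubini'[symmetric]) measurable
  also have "\<dots> = (\<integral>\<^sup>+x. 2 * ennreal (F x * (1 - F x)) \<partial>lborel)"
  proof (intro nn_integral_cong)
    fix x :: real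
    have "(\<integral>\<^sup>+\<omega>. \<integral>\<^sup>+\<omega>'. a \<omega> x * b \<omega>' x + a \<omega>' x * b \<omega> x \<partial>M \<partial>M) =
      (\<integral>\<^sup>+\<omega>. a \<omega> x * ennreal (1 - F x) + ennreal (F x) * b \<omega> x \<partial>M)"
      by (intro nn_integral_cong, subst nn_integral_add)
         (auto simp: nn_integral_cmult nn_integral_multc ia ib)
    also have "\<dots> = ennreal (F x) * ennreal (1 - F x) + ennreal (F x) * ennreal (1 - F x)"
      by (subst nn_integral_add) (auto simp: nn_integral_cmult nn_integral_multc ia ib)
    also have "\<dots> = 2 * ennreal (F x * (1 - F x))"
      using F by (simp add: ennreal_mult mult_2)
    finally show "(\<integral>\<^sup>+\<omega>. \<integral>\<^sup>+\<omega>'. a \<omega> x * b \<omega>' x + a \<omega>' x * b \<omega> x \<partial>M \<partial>M) = 2 * ennreal (F x * (1 - F x))" .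
  qed
  finally show ?thesis .
qed

locale vector_law_space = prob_space P for P :: "(nat \<Rightarrow> real) measure" +
  fixes n :: nat
  assumes sets_P [simp, measurable_cong]: "sets P = sets (Rn n)" and n_pos: "n \<ge> 1"

begin

abbreviation "S \<equiv> unif_sphere n"

lemma space_P [simp]: "space P = space (Rn n)"
  by (rule sets_eq_imp_space_eq) simp

sublocale S: prob_space S by (rule prob_space_unif_sphere)

sublocale PS: pair_prob_space P S ..

sublocale PP: pair_prob_space P P ..

sublocale SL: pair_sigma_finite S lborel ..

lemma proj_cdf_eq: "proj_cdf n P \<theta> x = prob {y \<in> space P. vinner n y \<theta> \<le> x}"
  unfolding proj_cdf_def cdf_def by (subst measure_distr) (auto intro!: arg_cong[where f=prob])

lemma proj_cdf_bounds: "0 \<le> proj_cdf n P \<theta> x" "proj_cdf n P \<theta> x \<le> 1"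
  by (auto simp: proj_cdf_eq)

lemma ennreal_proj_cdf: "ennreal (proj_cdf n P \<theta> x) = (\<integral>\<^sup>+y. (if vinner n y \<theta> \<le> x then 1 else 0) \<partial>P)"
proof -
  have "(\<integral>\<^sup>+y. (if vinner n y \<theta> \<le> x then 1 else 0) \<partial>P) = (\<integral>\<^sup>+y. indicator {y \<in> space P. vinner n y \<theta> \<le> x} y \<partial>P)"
    by (intro nn_integral_cong) auto
  also have "\<dots> = emeasure P {y \<in> space P. vinner n y \<theta> \<le> x}"
    by (rule nn_integral_indicator) measurable
  finally show ?thesis by (simp add: proj_cdf_eq emeasure_eq_measure)
qed

lemma measurable_proj_cdf [measurable (raw)]:
  assumes [measurable]: "f \<in> N \<rightarrow>\<^sub>M Rn n" "g \<in> borel_measurable N"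
  shows "(\<lambda>p. proj_cdf n P (f p) (g p)) \<in> borel_measurable N"
proof -
  have "(\<lambda>p. enn2real (\<integral>\<^sup>+y. (if vinner n y (f p) \<le> g p then 1 else 0) \<partial>P)) \<in> borel_measurable N"
    by measurable
  then show ?thesis
    unfolding ennreal_proj_cdf[symmetric] by (simp add: proj_cdf_bounds)
qed

lemma integrable_proj_cdf: "integrable S (\<lambda>\<theta>. proj_cdf n P \<theta> x)"
  by (rule S.integrable_const_bound[where B=1]) (auto simp: proj_cdf_bounds)

lemma typical_cdf_bounds: "0 \<le> typical_cdf n P x" "typical_cdf n P x \<le> 1"
  unfolding typical_cdf_def
  by (auto intro!: integral_nonneg_AE S.integral_le_const integrable_proj_cdf simp: proj_cdf_bounds)

lemma measurable_typical_cdf [measurable]: "typical_cdf n P \<in> borel_measurable borel"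
  unfolding typical_cdf_def by measurable

text \<open>
  The typical distribution function is that of \<open><X,\<theta>>\<close> with \<open>X\<close> and \<open>\<theta>\<close> independent, which makes
  \<open>mean_abs_diff_eq\<close> applicable to it.
\<close>

lemma typical_cdf_eq:
  "typical_cdf n P x = measure (P \<Otimes>\<^sub>M S) {p \<in> space (P \<Otimes>\<^sub>M S). vinner n (fst p) (snd p) \<le> x}"
proof -
  have "ennreal (typical_cdf n P x) = (\<integral>\<^sup>+\<theta>. ennreal (proj_cdf n P \<theta> x) \<partial>S)"
    unfolding typical_cdf_def
    by (rule nn_integral_eq_integral[symmetric]) (auto simp: integrable_proj_cdf proj_cdf_bounds)
  also have "\<dots> = (\<integral>\<^sup>+\<theta>. emeasure P ((\<lambda>y. (y, \<theta>)) -` {p \<in> space (P \<Otimes>\<^sub>M S). vinner n (fst p) (snd p) \<le> x}) \<partial>S)"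
    by (intro nn_integral_cong)
       (auto simp: proj_cdf_eq emeasure_eq_measure space_pair_measure intro!: arg_cong[where f=prob])
  also have "\<dots> = emeasure (P \<Otimes>\<^sub>M S) {p \<in> space (P \<Otimes>\<^sub>M S). vinner n (fst p) (snd p) \<le> x}"
    by (rule PS.emeasure_pair_measure_alt2[symmetric]) measurable
  finally show ?thesis
    using typical_cdf_bounds(1) by (simp add: PS.emeasure_eq_measure)
qed

text \<open>
  For fixed \<open>x\<close> this is the formula for the variance of \<open>F\<^sub>\<theta>(x)\<close>, arranged as a sum of
  nonnegative terms so that it can be integrated over the whole line without integrability conditions.
\<close>

lemma cdf_variance_decomposition:
  "(\<integral>\<^sup>+\<theta>. ennreal ((proj_cdf n P \<theta> x - typical_cdf n P x)\<^sup>2) \<partial>S)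
   + (\<integral>\<^sup>+\<theta>. ennreal (proj_cdf n P \<theta> x * (1 - proj_cdf n P \<theta> x)) \<partial>S)
   = ennreal (typical_cdf n P x * (1 - typical_cdf n P x))"
proof -
  let ?F = "\<lambda>\<theta>. proj_cdf n P \<theta> x" and ?G = "typical_cdf n P x"
  have pr: "S.prob (space (Rn n)) = 1" using S.prob_space by simp
  have "(\<integral>\<^sup>+\<theta>. ennreal ((?F \<theta> - ?G)\<^sup>2) \<partial>S) + (\<integral>\<^sup>+\<theta>. ennreal (?F \<theta> * (1 - ?F \<theta>)) \<partial>S)
     = (\<integral>\<^sup>+\<theta>. ennreal ((?F \<theta> - ?G)\<^sup>2) + ennreal (?F \<theta> * (1 - ?F \<theta>)) \<partial>S)"
    by (rule nn_integral_add[symmetric]) measurable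
  also have "\<dots> = (\<integral>\<^sup>+\<theta>. ennreal (?G\<^sup>2 - 2 * ?G * ?F \<theta> + ?F \<theta>) \<partial>S)"
  proof (intro nn_integral_cong)
    fix \<theta>
    have "ennreal ((?F \<theta> - ?G)\<^sup>2) + ennreal (?F \<theta> * (1 - ?F \<theta>)) = ennreal ((?F \<theta> - ?G)\<^sup>2 + ?F \<theta> * (1 - ?F \<theta>))"
      by (intro ennreal_plus[symmetric] mult_nonneg_nonneg) (auto simp: proj_cdf_bounds)
    then show "ennreal ((?F \<theta> - ?G)\<^sup>2) + ennreal (?F \<theta> * (1 - ?F \<theta>)) = ennreal (?G\<^sup>2 - 2 * ?G * ?F \<theta> + ?F \<theta>)"
      by (simp add: power2_eq_square algebra_simps)
  qed
  also have "\<dots> = ennreal (S.expectation (\<lambda>\<theta>. ?G\<^sup>2 - 2 * ?G * ?F \<theta> + ?F \<theta>))"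
  proof (rule nn_integral_eq_integral)
    show "AE \<theta> in S. 0 \<le> ?G\<^sup>2 - 2 * ?G * ?F \<theta> + ?F \<theta>"
    proof (rule AE_I2)
      fix \<theta>
      have "0 \<le> (?F \<theta> - ?G)\<^sup>2 + ?F \<theta> * (1 - ?F \<theta>)" using proj_cdf_bounds by simp
      then show "0 \<le> ?G\<^sup>2 - 2 * ?G * ?F \<theta> + ?F \<theta>" by (simp add: power2_eq_square algebra_simps)
    qed
  qed (use integrable_proj_cdf in simp)
  also have "S.expectation (\<lambda>\<theta>. ?G\<^sup>2 - 2 * ?G * ?F \<theta> + ?F \<theta>) = ?G\<^sup>2 - 2 * ?G * ?G + ?G"
    using integrable_proj_cdf by (simp add: typical_cdf_def[symmetric] pr)
  finally show ?thesis by (simp add: power2_eq_square algebra_simps)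
qed

lemma nn_integral_proj_gini:
  "(\<integral>\<^sup>+\<theta>. \<integral>\<^sup>+x. 2 * ennreal (proj_cdf n P \<theta> x * (1 - proj_cdf n P \<theta> x)) \<partial>lborel \<partial>S)
   = (\<integral>\<^sup>+p. ennreal (sphere_abs_mean n * vnorm n (\<lambda>i. fst p i - snd p i)) \<partial>(P \<Otimes>\<^sub>M P))"
proof -
  have "(\<integral>\<^sup>+\<theta>. \<integral>\<^sup>+x. 2 * ennreal (proj_cdf n P \<theta> x * (1 - proj_cdf n P \<theta> x)) \<partial>lborel \<partial>S)
    = (\<integral>\<^sup>+\<theta>. \<integral>\<^sup>+x. \<integral>\<^sup>+y. ennreal \<bar>vinner n x \<theta> - vinner n y \<theta>\<bar> \<partial>P \<partial>P \<partial>S)"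
    unfolding proj_cdf_eq by (subst mean_abs_diff_eq) auto
  also have "\<dots> = (\<integral>\<^sup>+x. \<integral>\<^sup>+\<theta>. \<integral>\<^sup>+y. ennreal \<bar>vinner n x \<theta> - vinner n y \<theta>\<bar> \<partial>P \<partial>S \<partial>P)"
    by (rule PS.Fubini') measurable
  also have "\<dots> = (\<integral>\<^sup>+x. \<integral>\<^sup>+y. \<integral>\<^sup>+\<theta>. ennreal \<bar>vinner n x \<theta> - vinner n y \<theta>\<bar> \<partial>S \<partial>P \<partial>P)"
    by (intro nn_integral_cong PS.Fubini') measurable
  also have "\<dots> = (\<integral>\<^sup>+x. \<integral>\<^sup>+y. ennreal (sphere_abs_mean n * vnorm n (\<lambda>i. x i - y i)) \<partial>P \<partial>P)"
    using vinner_lincomb[of n 1 _ 1] nn_sphere_abs_vinner[OF n_pos, of "\<lambda>i. _ i - _ i"] by simp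
  also have "\<dots> = (\<integral>\<^sup>+p. ennreal (sphere_abs_mean n * vnorm n (\<lambda>i. fst p i - snd p i)) \<partial>(P \<Otimes>\<^sub>M P))"
    by (subst nn_integral_fst[symmetric]) auto
  finally show ?thesis .
qed

lemma nn_integral_typical_gini:
  "(\<integral>\<^sup>+x. 2 * ennreal (typical_cdf n P x * (1 - typical_cdf n P x)) \<partial>lborel)
   = (\<integral>\<^sup>+x. \<integral>\<^sup>+y. ennreal (sphere_abs_mean n * sphere_pair_mean n (vnorm n x) (vnorm n y)) \<partial>P \<partial>P)"
proof -
  have "(\<integral>\<^sup>+x. 2 * ennreal (typical_cdf n P x * (1 - typical_cdf n P x)) \<partial>lborel)
    = (\<integral>\<^sup>+p. \<integral>\<^sup>+p'. ennreal \<bar>vinner n (fst p) (snd p) - vinner n (fst p') (snd p')\<bar> \<partial>(P \<Otimes>\<^sub>M S) \<partial>(P \<Otimes>\<^sub>M S))"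
    unfolding typical_cdf_eq by (subst PS.mean_abs_diff_eq) auto
  also have "\<dots> = (\<integral>\<^sup>+p. \<integral>\<^sup>+y. \<integral>\<^sup>+\<theta>'. ennreal \<bar>vinner n (fst p) (snd p) - vinner n y \<theta>'\<bar> \<partial>S \<partial>P \<partial>(P \<Otimes>\<^sub>M S))"
    by (intro nn_integral_cong, subst S.nn_integral_fst[symmetric]) auto
  also have "\<dots> = (\<integral>\<^sup>+x. \<integral>\<^sup>+\<theta>. \<integral>\<^sup>+y. \<integral>\<^sup>+\<theta>'. ennreal \<bar>vinner n x \<theta> - vinner n y \<theta>'\<bar> \<partial>S \<partial>P \<partial>S \<partial>P)"
    by (subst S.nn_integral_fst[symmetric]) auto
  also have "\<dots> = (\<integral>\<^sup>+x. \<integral>\<^sup>+y. \<integral>\<^sup>+\<theta>. \<integral>\<^sup>+\<theta>'. ennreal \<bar>vinner n x \<theta> - vinner n y \<theta>'\<bar> \<partial>S \<partial>S \<partial>P \<partial>P)"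
    by (intro nn_integral_cong PS.Fubini') measurable
  finally show ?thesis unfolding nn_sphere_pair[OF n_pos] .
qed

text \<open>
  Integrate \<open>cdf_variance_decomposition\<close> over the line and evaluate the two terms that do not
  involve \<open>F\<^sub>\<theta> - F\<close> as mean absolute differences.
\<close>

lemma energy_decomposition:
  "2 * (\<integral>\<^sup>+\<theta>. \<integral>\<^sup>+x. ennreal ((proj_cdf n P \<theta> x - typical_cdf n P x)\<^sup>2) \<partial>lborel \<partial>S)
   + (\<integral>\<^sup>+p. ennreal (sphere_abs_mean n * vnorm n (\<lambda>i. fst p i - snd p i)) \<partial>(P \<Otimes>\<^sub>M P))
   = (\<integral>\<^sup>+x. \<integral>\<^sup>+y. ennreal (sphere_abs_mean n * sphere_pair_mean n (vnorm n x) (vnorm n y)) \<partial>P \<partial>P)"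
proof -
  let ?v = "\<lambda>\<theta> x. ennreal ((proj_cdf n P \<theta> x - typical_cdf n P x)\<^sup>2)"
  let ?g = "\<lambda>\<theta> x. ennreal (proj_cdf n P \<theta> x * (1 - proj_cdf n P \<theta> x))"
  have "(\<integral>\<^sup>+x. 2 * ennreal (typical_cdf n P x * (1 - typical_cdf n P x)) \<partial>lborel)
    = (\<integral>\<^sup>+x. 2 * (\<integral>\<^sup>+\<theta>. ?v \<theta> x \<partial>S) + (\<integral>\<^sup>+\<theta>. 2 * ?g \<theta> x \<partial>S) \<partial>lborel)"
    unfolding cdf_variance_decomposition[symmetric] distrib_left
    by (intro nn_integral_cong arg_cong2[where f="(+)"] refl nn_integral_cmult[symmetric]) measurable
  also have "\<dots> = 2 * (\<integral>\<^sup>+x. \<integral>\<^sup>+\<theta>. ?v \<theta> x \<partial>S \<partial>lborel) + (\<integral>\<^sup>+x. \<integral>\<^sup>+\<theta>. 2 * ?g \<theta> x \<partial>S \<partial>lborel)"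
    by (subst nn_integral_add, measurable) (subst nn_integral_cmult, auto)
  also have "(\<integral>\<^sup>+x. \<integral>\<^sup>+\<theta>. ?v \<theta> x \<partial>S \<partial>lborel) = (\<integral>\<^sup>+\<theta>. \<integral>\<^sup>+x. ?v \<theta> x \<partial>lborel \<partial>S)"
    by (rule SL.Fubini') measurable
  also have "(\<integral>\<^sup>+x. \<integral>\<^sup>+\<theta>. 2 * ?g \<theta> x \<partial>S \<partial>lborel) = (\<integral>\<^sup>+\<theta>. \<integral>\<^sup>+x. 2 * ?g \<theta> x \<partial>lborel \<partial>S)"
    by (rule SL.Fubini') measurable
  finally show ?thesis
    unfolding nn_integral_typical_gini nn_integral_proj_gini by simp
qed

end

section \<open>Comparison with the functional R\<close>

text \<open>
  With \<open>a = r\<^sup>2 - N\<close> and \<open>b = s\<^sup>2 - N\<close>, the numerator \<open>2 (a\<^sup>2 + b\<^sup>2)\<close> is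
  \<open>(r\<^sup>2 - s\<^sup>2)\<^sup>2 + (q - 2 N)\<^sup>2\<close>: the first square controls the case \<open>q \<ge> N\<close>, the second one the
  case of small \<open>q\<close>, where the factor \<open>1 - \<rho>\<^sup>2\<close> need not be small.
\<close>

lemma anisotropy_bound:
  fixes r s N :: real
  assumes "N > 0" "r \<ge> 0" "s \<ge> 0"
  defines "q \<equiv> r\<^sup>2 + s\<^sup>2"
  shows "sqrt (q / N) * (1 - (2 * r * s / q)\<^sup>2) \<le> 2 * ((r\<^sup>2 - N)\<^sup>2 + (s\<^sup>2 - N)\<^sup>2) / N\<^sup>2"
proof -
  have id: "2 * ((r\<^sup>2 - N)\<^sup>2 + (s\<^sup>2 - N)\<^sup>2) = (r\<^sup>2 - s\<^sup>2)\<^sup>2 + (2 * N - q)\<^sup>2"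
    by (simp add: q_def power2_eq_square algebra_simps)
  have q0: "q \<ge> 0" by (simp add: q_def)
  show ?thesis
  proof (cases "q \<ge> N")
    case True
    then have q: "q > 0" using \<open>N > 0\<close> by linarith
    have t: "q / N \<ge> 1" using True \<open>N > 0\<close> by simp
    \<comment> \<open>This power of \<open>q / N\<close> turns the denominator \<open>q\<^sup>2\<close> into \<open>N\<^sup>2\<close>.\<close>
    have "sqrt (q / N) \<le> (q / N)\<^sup>2"
    proof (rule real_le_lsqrt)
      have "(q / N) ^ 1 \<le> (q / N) ^ 4" using t by (intro power_increasing) auto
      then show "q / N \<le> ((q / N)\<^sup>2)\<^sup>2" by simp
    qed simp
    moreover have d: "1 - (2 * r * s / q)\<^sup>2 = (r\<^sup>2 - s\<^sup>2)\<^sup>2 / q\<^sup>2"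
    proof -
      have "q\<^sup>2 - (2 * r * s)\<^sup>2 = (r\<^sup>2 - s\<^sup>2)\<^sup>2"
        by (simp add: q_def power2_eq_square algebra_simps)
      moreover have "1 - (2 * r * s / q)\<^sup>2 = (q\<^sup>2 - (2 * r * s)\<^sup>2) / q\<^sup>2"
        using q by (simp only: power_divide diff_divide_distrib) simp
      ultimately show ?thesis by simp
    qed
    ultimately have "sqrt (q / N) * (1 - (2 * r * s / q)\<^sup>2) \<le> (q / N)\<^sup>2 * ((r\<^sup>2 - s\<^sup>2)\<^sup>2 / q\<^sup>2)"
      unfolding d by (intro mult_right_mono) auto
    also have "\<dots> = (r\<^sup>2 - s\<^sup>2)\<^sup>2 / N\<^sup>2" using q by (simp add: power_divide)
    also have "\<dots> \<le> 2 * ((r\<^sup>2 - N)\<^sup>2 + (s\<^sup>2 - N)\<^sup>2) / N\<^sup>2"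
      unfolding id by (intro divide_right_mono) auto
    finally show ?thesis .
  next
    case False
    have t: "0 \<le> sqrt (q / N)" "sqrt (q / N) \<le> 1" using False q0 \<open>N > 0\<close> by auto
    have "sqrt (q / N) * (1 - (2 * r * s / q)\<^sup>2) \<le> sqrt (q / N) * 1"
      using t by (intro mult_left_mono) auto
    also have "\<dots> \<le> 1" using t by simp
    \<comment> \<open>Below \<open>q = N\<close> the distance from \<open>q\<close> to \<open>2 N\<close> exceeds \<open>N\<close>, while the left-hand side is at most 1.\<close>
    also have "1 \<le> (2 * N - q)\<^sup>2 / N\<^sup>2"
      using False \<open>N > 0\<close> by (simp add: power_mono)
    also have "\<dots> \<le> 2 * ((r\<^sup>2 - N)\<^sup>2 + (s\<^sup>2 - N)\<^sup>2) / N\<^sup>2"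
      unfolding id by (intro divide_right_mono) auto
    finally show ?thesis .
  qed
qed

text \<open>
  The pointwise form of the comparison. Here \<open>K\<close> stands for the constant \<open>\<kappa>\<close> divided by its leading
  term \<open>sqrt (2 / (\<pi> n))\<close>, \<open>J\<close> for \<open>sphere_pair_mean\<close>, and \<open>D\<close> for \<open>|x - y|\<close>.
\<close>

lemma integrand_bound:
  fixes r s K D J :: real
  assumes n: "n \<ge> 2" and rs: "r \<ge> 0" "s \<ge> 0"
  defines "q \<equiv> r\<^sup>2 + s\<^sup>2"
  assumes D: "0 \<le> D" "D \<le> 2 * sqrt q"
    and K: "\<bar>K - (1 + 1 / (4 * real n))\<bar> \<le> 28 / (real n)\<^sup>2"
    and J: "\<bar>J - sqrt q * (1 - (2 * r * s / q)\<^sup>2 / (8 * real n))\<bar> \<le> sqrt q / (real n)\<^sup>2"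
  shows "\<bar>K * (J - D) - (sqrt q * (1 + 1 / (8 * real n)) - D * (1 + 1 / (4 * real n)))\<bar>
     \<le> sqrt q * (1 - (2 * r * s / q)\<^sup>2) / (8 * real n) + 94 * sqrt q / (real n)\<^sup>2"
proof -
  define h where "h = 1 / real n"
  define \<rho> where "\<rho> = (2 * r * s / q)\<^sup>2"
  define e where "e = K - (1 + h / 4)"
  define f where "f = J - sqrt q * (1 - \<rho> * h / 8)"
  have h: "0 < h" "h \<le> 1 / 2" using n by (auto simp: h_def field_simps)
  have e: "\<bar>e\<bar> \<le> 28 * h\<^sup>2" using K by (simp add: e_def h_def power_divide)
  have f: "\<bar>f\<bar> \<le> sqrt q * h\<^sup>2"
  proof -
    have hn: "x * h / 8 = x / (8 * real n)" "x * h\<^sup>2 = x / (real n)\<^sup>2" for x :: real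
      by (simp_all add: h_def power_one_over)
    show ?thesis using J unfolding f_def hn \<rho>_def .
  qed
  have q0: "q \<ge> 0" by (simp add: q_def)
  have "2 * r * s \<le> q" using sum_squares_bound[of r s] by (simp add: q_def)
  then have "0 \<le> 2 * r * s / q" "2 * r * s / q \<le> 1" using rs q0 by (auto simp: divide_le_eq_1)
  then have \<rho>: "0 \<le> \<rho>" "\<rho> \<le> 1" by (auto simp: \<rho>_def power_le_one)
  have "h\<^sup>2 \<le> (1 / 2)\<^sup>2" using h by (intro power_mono) auto
  then have h2: "h\<^sup>2 \<le> 1 / 4" by (simp add: power2_eq_square)
  have Kb: "\<bar>K\<bar> \<le> 9" using e h h2 unfolding e_def by linarith
  \<comment> \<open>The first-order terms combine to \<open>sqrt q * (1 - \<rho>) * h / 8\<close>; the four others are bounded by 1, 28, 9 and 56 times \<open>sqrt q * h\<^sup>2\<close>.\<close>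
  have eq: "K * (J - D) - (sqrt q * (1 + h / 8) - D * (1 + h / 4))
    = sqrt q * ((1 - \<rho>) * (h / 8)) - sqrt q * (\<rho> * h\<^sup>2 / 32) + sqrt q * (e * (1 - \<rho> * h / 8)) + K * f - e * D"
    unfolding f_def e_def by (simp add: field_simps power2_eq_square)
  have b1: "\<bar>sqrt q * (\<rho> * h\<^sup>2 / 32)\<bar> \<le> sqrt q * h\<^sup>2"
  proof -
    have "\<rho> * h\<^sup>2 \<le> 1 * h\<^sup>2" using \<rho> by (intro mult_right_mono) auto
    then have "\<rho> * h\<^sup>2 / 32 \<le> h\<^sup>2" using zero_le_power2[of h] by linarith
    then have "sqrt q * (\<rho> * h\<^sup>2 / 32) \<le> sqrt q * h\<^sup>2" using q0 by (intro mult_left_mono) auto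
    then show ?thesis using q0 \<rho> by (subst abs_of_nonneg) auto
  qed
  have b2: "\<bar>sqrt q * (e * (1 - \<rho> * h / 8))\<bar> \<le> sqrt q * (28 * h\<^sup>2)"
  proof -
    have "0 \<le> \<rho> * h" using \<rho> h by simp
    moreover have "\<rho> * h \<le> 1 * 1" using \<rho> h by (intro mult_mono) auto
    ultimately have "\<bar>1 - \<rho> * h / 8\<bar> \<le> 1" by (auto simp: abs_le_iff)
    then have "\<bar>e\<bar> * \<bar>1 - \<rho> * h / 8\<bar> \<le> (28 * h\<^sup>2) * 1" using e by (intro mult_mono) auto
    then show ?thesis using q0 by (simp add: abs_mult mult_left_mono)
  qed
  have b3: "\<bar>K * f\<bar> \<le> 9 * (sqrt q * h\<^sup>2)"
    unfolding abs_mult using Kb f by (intro mult_mono) auto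
  have b4: "\<bar>e * D\<bar> \<le> (28 * h\<^sup>2) * (2 * sqrt q)"
    unfolding abs_mult using e D by (intro mult_mono) auto
  have b0: "\<bar>sqrt q * ((1 - \<rho>) * (h / 8))\<bar> = sqrt q * ((1 - \<rho>) * (h / 8))"
    using q0 \<rho> h by simp
  have "\<bar>K * (J - D) - (sqrt q * (1 + h / 8) - D * (1 + h / 4))\<bar>
     \<le> sqrt q * ((1 - \<rho>) * (h / 8)) + 94 * (sqrt q * h\<^sup>2)"
    unfolding eq using b0 b1 b2 b3 b4 by (simp add: mult_ac)
  then show ?thesis
    unfolding \<rho>_def[symmetric] by (simp add: h_def power_divide mult.commute)
qed

context vector_law_space

begin

lemma integral_pair_fst:
  fixes f :: "(nat \<Rightarrow> real) \<Rightarrow> real"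
  assumes "integrable P f"
  shows "integrable (P \<Otimes>\<^sub>M P) (\<lambda>p. f (fst p))" "(\<integral>p. f (fst p) \<partial>(P \<Otimes>\<^sub>M P)) = expectation f"
proof -
  have [measurable]: "f \<in> borel_measurable P" using assms by auto
  have d: "distr (P \<Otimes>\<^sub>M P) P fst = P" by (rule distr_pair_fst) unfold_locales
  show "integrable (P \<Otimes>\<^sub>M P) (\<lambda>p. f (fst p))"
    using assms by (subst (asm) d[symmetric]) (simp add: integrable_distr_eq)
  show "(\<integral>p. f (fst p) \<partial>(P \<Otimes>\<^sub>M P)) = expectation f"
    by (subst (3) d[symmetric]) (simp add: integral_distr)
qed

lemma integral_pair_snd:
  fixes f :: "(nat \<Rightarrow> real) \<Rightarrow> real"
  assumes "integrable P f"
  shows "integrable (P \<Otimes>\<^sub>M P) (\<lambda>p. f (snd p))" "(\<integral>p. f (snd p) \<partial>(P \<Otimes>\<^sub>M P)) = expectation f"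
proof -
  have f [measurable]: "f \<in> borel_measurable P" using assms by auto
  have "integrable (P \<Otimes>\<^sub>M P) (\<lambda>(x, y). f (snd (y, x)))"
    using integral_pair_fst(1)[OF assms] by (simp add: case_prod_beta')
  then show "integrable (P \<Otimes>\<^sub>M P) (\<lambda>p. f (snd p))"
    by (subst PP.integrable_product_swap_iff[symmetric]) simp
  show "(\<integral>p. f (snd p) \<partial>(P \<Otimes>\<^sub>M P)) = expectation f"
    using integral_pair_fst(2)[OF assms] PP.integral_product_swap[of "\<lambda>p. f (snd p)"]
    by (simp add: case_prod_beta')
qed

text \<open>
  The Bochner integrals in the statement are zero by convention when they diverge; finiteness of the
  iterated nonnegative integral excludes this for almost every direction.
\<close>

lemma integral_omega_sq:
  assumes "(\<integral>\<^sup>+\<theta>. \<integral>\<^sup>+x. ennreal ((proj_cdf n P \<theta> x - typical_cdf n P x)\<^sup>2) \<partial>lborel \<partial>S) = ennreal v" "v \<ge> 0"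
  shows "(\<integral>\<theta>. (omega (proj_cdf n P \<theta>) (typical_cdf n P))\<^sup>2 \<partial>S) = v"
proof -
  let ?g = "\<lambda>\<theta>. \<integral>\<^sup>+x. ennreal ((proj_cdf n P \<theta> x - typical_cdf n P x)\<^sup>2) \<partial>lborel"
  have om: "(omega (proj_cdf n P \<theta>) (typical_cdf n P))\<^sup>2 = enn2real (?g \<theta>)" if "\<theta> \<in> space S" for \<theta>
  proof -
    have [measurable]: "proj_cdf n P \<theta> \<in> borel_measurable borel"
      using measurable_proj_cdf[of "\<lambda>_. \<theta>" borel "\<lambda>x. x"] that by simp
    have "(omega (proj_cdf n P \<theta>) (typical_cdf n P))\<^sup>2 = (\<integral>x. (proj_cdf n P \<theta> x - typical_cdf n P x)\<^sup>2 \<partial>lborel)"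
      by (simp add: omega_def integral_nonneg_AE)
    also have "\<dots> = enn2real (?g \<theta>)"
      by (rule integral_eq_nn_integral) auto
    finally show ?thesis .
  qed
  have [measurable]: "?g \<in> borel_measurable S" by measurable
  have "AE \<theta> in S. ?g \<theta> \<noteq> \<infinity>"
    using assms by (intro nn_integral_noteq_infinite) auto
  then have "(\<integral>\<^sup>+\<theta>. ennreal (enn2real (?g \<theta>)) \<partial>S) = (\<integral>\<^sup>+\<theta>. ?g \<theta> \<partial>S)"
    by (intro nn_integral_cong_AE) (auto elim!: eventually_mono simp: less_top)
  then have "(\<integral>\<theta>. enn2real (?g \<theta>) \<partial>S) = v"
    using assms by (subst integral_eq_nn_integral) auto
  moreover have "(\<integral>\<theta>. (omega (proj_cdf n P \<theta>) (typical_cdf n P))\<^sup>2 \<partial>S) = (\<integral>\<theta>. enn2real (?g \<theta>) \<partial>S)"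
    using om by (intro Bochner_Integration.integral_cong) auto
  ultimately show ?thesis by simp
qed

text \<open>
  Integrate \<open>integrand_bound\<close>: \<open>q\<close> has mean \<open>2 n\<close>, and the bound from \<open>anisotropy_bound\<close> has mean
  \<open>4 Var(|X|\<^sup>2) / n\<^sup>2\<close>.
\<close>

lemma mean_omega_sq_approx:
  assumes n2: "n \<ge> 2" and int: "integrable P (\<lambda>x. (vnorm n x)\<^sup>2)" and mean: "expectation (\<lambda>x. (vnorm n x)\<^sup>2) = real n"
    and int4: "integrable P (\<lambda>x. ((vnorm n x)\<^sup>2 - n)\<^sup>2)"
  shows "\<bar>(\<integral>\<theta>. (omega (proj_cdf n P \<theta>) (typical_cdf n P))\<^sup>2 \<partial>S)
       - 1 / sqrt (2 * pi) * (\<integral>(x, y). R_fun n x y \<partial>(P \<Otimes>\<^sub>M P))\<bar>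
     \<le> 141 * (1 + expectation (\<lambda>x. ((vnorm n x)\<^sup>2 - n)\<^sup>2) / n) / (real n)\<^sup>2"
proof -
  let ?PP = "P \<Otimes>\<^sub>M P"
  define \<kappa> where "\<kappa> = sphere_abs_mean n"
  define r s D q J where "r p = vnorm n (fst p)" and "s p = vnorm n (snd p)"
    and "D p = vnorm n (\<lambda>i. fst p i - snd p i)" and "q p = (r p)\<^sup>2 + (s p)\<^sup>2"
    and "J p = sphere_pair_mean n (r p) (s p)" for p :: "(nat \<Rightarrow> real) \<times> (nat \<Rightarrow> real)"
  define a where "a p = ((r p)\<^sup>2 - n)\<^sup>2 + ((s p)\<^sup>2 - n)\<^sup>2" for p
  have npos: "real n > 0" using n2 by simp
  have \<kappa>0: "\<kappa> \<ge> 0" by (simp add: \<kappa>_def sphere_abs_mean_nonneg)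
  have r0: "r p \<ge> 0" and s0: "s p \<ge> 0" and D0: "D p \<ge> 0" and q0: "q p \<ge> 0" for p
    by (auto simp: r_def s_def D_def q_def)
  have [measurable]: "r \<in> borel_measurable ?PP" "s \<in> borel_measurable ?PP" "D \<in> borel_measurable ?PP"
    unfolding r_def[abs_def] s_def[abs_def] D_def[abs_def] by measurable
  have [measurable]: "q \<in> borel_measurable ?PP" "J \<in> borel_measurable ?PP"
    unfolding q_def[abs_def] J_def[abs_def] by measurable
  have Dq: "D p \<le> 2 * sqrt (q p)" for p
    unfolding D_def q_def r_def s_def by (rule vnorm_diff_le)
  have Jq: "\<bar>J p - sqrt (q p) * (1 - (2 * r p * s p / q p)\<^sup>2 / (8 * real n))\<bar> \<le> sqrt (q p) / (real n)\<^sup>2" for p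
    using sphere_pair_mean_approx[OF n_pos r0 s0, of p p] by (simp add: J_def q_def)
  have J02: "0 \<le> J p \<and> J p \<le> 2 * sqrt (q p)" for p
  proof -
    define \<rho> where "\<rho> = (2 * r p * s p / q p)\<^sup>2"
    have "2 * r p * s p \<le> q p" using sum_squares_bound[of "r p" "s p"] by (simp add: q_def)
    then have "0 \<le> 2 * r p * s p / q p" "2 * r p * s p / q p \<le> 1" using r0[of p] s0[of p] q0[of p] by (auto simp: divide_le_eq_1)
    then have "0 \<le> \<rho>" "\<rho> \<le> 1" by (auto simp: \<rho>_def power_le_one)
    moreover have "8 * real n \<ge> 16" using n2 by simp
    ultimately have "\<rho> / (8 * real n) \<le> 1 / 16" "0 \<le> \<rho> / (8 * real n)"
      by (auto intro!: frac_le)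
    moreover have "1 / (real n)\<^sup>2 \<le> 1 / 2\<^sup>2" using n2 by (intro frac_le power_mono) auto
    ultimately have "0 \<le> sqrt (q p) * (1 - \<rho> / (8 * real n) - 1 / (real n)\<^sup>2)"
       "sqrt (q p) * (1 - \<rho> / (8 * real n) + 1 / (real n)\<^sup>2) \<le> sqrt (q p) * 2"
      using q0[of p] by (auto intro!: mult_nonneg_nonneg mult_left_mono simp: power2_eq_square)
    moreover have "\<bar>J p - sqrt (q p) * (1 - \<rho> / (8 * real n))\<bar> \<le> sqrt (q p) / (real n)\<^sup>2"
      using Jq[of p] by (simp add: \<rho>_def)
    ultimately show ?thesis by (simp add: algebra_simps abs_le_iff)
  qed
  have iq: "integrable ?PP q" and Eq: "(\<integral>p. q p \<partial>?PP) = 2 * n"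
    using integral_pair_fst[OF int] integral_pair_snd[OF int] mean by (simp_all add: q_def[abs_def] r_def s_def)
  have ia: "integrable ?PP a" and Ea: "(\<integral>p. a p \<partial>?PP) = 2 * expectation (\<lambda>x. ((vnorm n x)\<^sup>2 - n)\<^sup>2)"
    using integral_pair_fst[OF int4] integral_pair_snd[OF int4] by (simp_all add: a_def[abs_def] r_def s_def)
  have sq: "sqrt t \<le> 1 + t" if "t \<ge> 0" for t :: real
    using that by (intro real_le_lsqrt) (auto simp: power2_eq_square algebra_simps)
  have isq: "integrable ?PP (\<lambda>p. sqrt (q p))"
    by (rule Bochner_Integration.integrable_bound[of _ "\<lambda>p. 1 + q p"])
       (use iq q0 sq in \<open>auto intro!: AE_I2\<close>)
  have iD: "integrable ?PP D"
    by (rule Bochner_Integration.integrable_bound[of _ "\<lambda>p. 2 * sqrt (q p)"])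
       (use isq D0 Dq q0 in \<open>auto intro!: AE_I2\<close>)
  have iJ: "integrable ?PP J"
    by (rule Bochner_Integration.integrable_bound[of _ "\<lambda>p. 2 * sqrt (q p)"])
       (use isq J02 q0 in \<open>auto intro!: AE_I2\<close>)
  let ?V = "\<integral>\<^sup>+\<theta>. \<integral>\<^sup>+x. ennreal ((proj_cdf n P \<theta> x - typical_cdf n P x)\<^sup>2) \<partial>lborel \<partial>S"
  define ED EJ where "ED = (\<integral>p. D p \<partial>?PP)" and "EJ = (\<integral>p. J p \<partial>?PP)"
  have "2 * ?V + (\<integral>\<^sup>+p. ennreal (\<kappa> * D p) \<partial>?PP) = (\<integral>\<^sup>+x. \<integral>\<^sup>+y. ennreal (\<kappa> * J (x, y)) \<partial>P \<partial>P)"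
    using energy_decomposition by (simp add: \<kappa>_def D_def J_def r_def s_def)
  also have "(\<integral>\<^sup>+x. \<integral>\<^sup>+y. ennreal (\<kappa> * J (x, y)) \<partial>P \<partial>P) = (\<integral>\<^sup>+p. ennreal (\<kappa> * J p) \<partial>?PP)"
    by (rule nn_integral_fst[of "\<lambda>p. ennreal (\<kappa> * J p)"]) measurable
  also have "(\<integral>\<^sup>+p. ennreal (\<kappa> * J p) \<partial>?PP) = ennreal (\<kappa> * EJ)"
    using iJ J02 \<kappa>0 by (subst nn_integral_eq_integral) (auto simp: EJ_def)
  also have "(\<integral>\<^sup>+p. ennreal (\<kappa> * D p) \<partial>?PP) = ennreal (\<kappa> * ED)"
    using iD D0 \<kappa>0 by (subst nn_integral_eq_integral) (auto simp: ED_def)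
  finally have V: "2 * ?V + ennreal (\<kappa> * ED) = ennreal (\<kappa> * EJ)" .
  define v where "v = enn2real ?V"
  \<comment> \<open>The right-hand side is finite, so the energy identity may be rearranged in the reals.\<close>
  have "2 * ?V \<noteq> \<top>" using V by (metis ennreal_neq_top ennreal_add_eq_top)
  then have "?V \<noteq> \<top>" by (metis ennreal_mult_top zero_neq_numeral)
  then have v: "?V = ennreal v" "v \<ge> 0" by (auto simp: v_def less_top)
  have ED0: "ED \<ge> 0" "EJ \<ge> 0" using D0 J02 by (auto simp: ED_def EJ_def intro!: integral_nonneg_AE)
  have "ennreal (2 * v + \<kappa> * ED) = ennreal (\<kappa> * EJ)"
    using V ED0 \<kappa>0 v(2) unfolding v(1) by (simp add: ennreal_mult)
  then have v2: "2 * v = \<kappa> * (EJ - ED)"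
    using ED0 \<kappa>0 v(2) by (subst (asm) ennreal_inj) (auto simp: right_diff_distrib)
  have omega: "(\<integral>\<theta>. (omega (proj_cdf n P \<theta>) (typical_cdf n P))\<^sup>2 \<partial>S) = v"
    by (rule integral_omega_sq[OF v])
  \<comment> \<open>Normalised so that \<open>\<kappa> / 2 = K / sqrt (2 * pi * n)\<close>, which makes \<open>K = 1 + 1 / (4 n) + O(1 / n\<^sup>2)\<close>.\<close>
  define K where "K = \<kappa> * sqrt (pi * n / 2)"
  have K: "\<bar>K - (1 + 1 / (4 * real n))\<bar> \<le> 28 / (real n)\<^sup>2"
    using sphere_abs_mean_asymp[OF n2] by (simp add: K_def \<kappa>_def)
  define R where "R p = sqrt (q p) * (1 + 1 / (8 * real n)) - D p * (1 + 1 / (4 * real n))" for p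
  have iR: "integrable ?PP R" unfolding R_def[abs_def] using isq iD by simp
  have ER: "(\<integral>(x, y). R_fun n x y \<partial>?PP) = (\<integral>p. R p \<partial>?PP) / sqrt n"
  proof -
    have "(\<lambda>(x, y). R_fun n x y) = (\<lambda>p. R p / sqrt n)"
      by (auto simp: fun_eq_iff R_fun_def R_def q_def r_def s_def D_def diff_divide_distrib)
    then show ?thesis by simp
  qed
  have vK: "v = 1 / sqrt (2 * pi) * (K * (EJ - ED) / sqrt n)"
  proof -
    have "sqrt (pi * n / 2) = sqrt (2 * pi) * sqrt n / 2"
      using npos by (simp add: real_sqrt_mult real_sqrt_divide field_simps)
    then have K_eq: "K = \<kappa> * (sqrt (2 * pi) * sqrt n / 2)" by (simp only: K_def)
    have "1 / sqrt (2 * pi) * (K * (EJ - ED) / sqrt n) = \<kappa> * (EJ - ED) / 2"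
      unfolding K_eq using npos by simp
    moreover have "v = \<kappa> * (EJ - ED) / 2" using v2 by simp
    ultimately show ?thesis by (simp only:)
  qed
  \<comment> \<open>\<open>sqrt (q / n)\<close> is replaced by the larger \<open>(1 + q / n) / 2\<close>, whose mean is \<open>3 / 2\<close>; this gives the constant \<open>141 = 94 * 3 / 2\<close>.\<close>
  define B where "B p = 94 * (1 + q p / n) / 2 / (real n)\<^sup>2 + 2 * a p / (real n)\<^sup>2 / (8 * real n)" for p
  have pt: "\<bar>(K * (J p - D p) - R p) / sqrt n\<bar> \<le> B p" for p
  proof -
    have "\<bar>K * (J p - D p) - R p\<bar> \<le> sqrt (q p) * (1 - (2 * r p * s p / q p)\<^sup>2) / (8 * real n) + 94 * sqrt (q p) / (real n)\<^sup>2"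
      unfolding R_def q_def using integrand_bound[OF n2 r0 s0 D0 _ K, of p p p "J p"] Dq[of p] Jq[of p]
      by (simp add: q_def)
    then have "\<bar>(K * (J p - D p) - R p) / sqrt n\<bar> \<le> (sqrt (q p) * (1 - (2 * r p * s p / q p)\<^sup>2) / (8 * real n) + 94 * sqrt (q p) / (real n)\<^sup>2) / sqrt n"
      by (simp add: divide_right_mono)
    also have "\<dots> = sqrt (q p / n) * (1 - (2 * r p * s p / q p)\<^sup>2) / (8 * real n) + 94 * sqrt (q p / n) / (real n)\<^sup>2"
      by (simp add: real_sqrt_divide add_divide_distrib mult_ac)
    also have "\<dots> \<le> (2 * a p / (real n)\<^sup>2) / (8 * real n) + 94 * ((1 + q p / n) / 2) / (real n)\<^sup>2"
    proof (intro add_mono divide_right_mono mult_left_mono)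
      show "sqrt (q p / n) * (1 - (2 * r p * s p / q p)\<^sup>2) \<le> 2 * a p / (real n)\<^sup>2"
        unfolding a_def q_def by (rule anisotropy_bound[OF npos r0 s0])
      have "0 \<le> (sqrt (q p / n) - 1)\<^sup>2" by simp
      then show "sqrt (q p / n) \<le> (1 + q p / n) / 2"
        using q0[of p] npos by (simp add: power2_eq_square algebra_simps)
    qed auto
    finally show ?thesis by (simp add: B_def)
  qed
  have iB: "integrable ?PP B" unfolding B_def[abs_def] using iq ia by simp
  have EB: "(\<integral>p. B p \<partial>?PP) = 141 / (real n)\<^sup>2 + expectation (\<lambda>x. ((vnorm n x)\<^sup>2 - n)\<^sup>2) / n / (2 * (real n)\<^sup>2)"
    unfolding B_def[abs_def] using iq ia npos PP.prob_space
    by (simp add: Eq Ea field_simps)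
  have "v - 1 / sqrt (2 * pi) * ((\<integral>p. R p \<partial>?PP) / sqrt n)
    = 1 / sqrt (2 * pi) * (\<integral>p. (K * (J p - D p) - R p) / sqrt n \<partial>?PP)"
    using iJ iD iR by (simp add: vK EJ_def ED_def diff_divide_distrib right_diff_distrib)
  also have "\<bar>\<dots>\<bar> \<le> 1 * (\<integral>p. B p \<partial>?PP)"
  proof (subst abs_mult, rule mult_mono)
    have "1 \<le> sqrt (2 * pi)" using pi_gt3 by (intro real_le_rsqrt) simp
    then show "\<bar>1 / sqrt (2 * pi)\<bar> \<le> 1" by simp
    have "\<bar>\<integral>p. (K * (J p - D p) - R p) / sqrt n \<partial>?PP\<bar> \<le> (\<integral>p. \<bar>(K * (J p - D p) - R p) / sqrt n\<bar> \<partial>?PP)"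
      by (rule integral_abs_bound)
    also have "\<dots> \<le> (\<integral>p. B p \<partial>?PP)"
      using iJ iD iR iB pt by (intro integral_mono) auto
    finally show "\<bar>\<integral>p. (K * (J p - D p) - R p) / sqrt n \<partial>?PP\<bar> \<le> (\<integral>p. B p \<partial>?PP)" .
  qed auto
  also have "1 * (\<integral>p. B p \<partial>?PP) \<le> 141 * (1 + expectation (\<lambda>x. ((vnorm n x)\<^sup>2 - n)\<^sup>2) / n) / (real n)\<^sup>2"
  proof -
    define A where "A = expectation (\<lambda>x. ((vnorm n x)\<^sup>2 - n)\<^sup>2) / n"
    have "A \<ge> 0" by (simp add: A_def)
    then have "A / (2 * (real n)\<^sup>2) \<le> 141 * A / (real n)\<^sup>2" using npos by (simp add: field_simps)
    then show ?thesis unfolding EB A_def[symmetric] by (simp add: distrib_left add_divide_distrib)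
  qed
  finally show ?thesis unfolding omega ER .
qed

end

theorem proposition4p2:
  shows "\<exists>c::real. c > 0 \<and>
    (\<forall>(n::nat) (P :: (nat \<Rightarrow> real) measure).
       n \<ge> 2 \<longrightarrow> vector_law n P \<longrightarrow>
       integrable P (\<lambda>x. (vnorm n x)\<^sup>2) \<longrightarrow> (\<integral>x. (vnorm n x)\<^sup>2 \<partial>P) = real n \<longrightarrow>
       ennreal \<bar>(\<integral>\<theta>. (omega (proj_cdf n P \<theta>) (typical_cdf n P))\<^sup>2 \<partial>unif_sphere n)
                 - 1 / sqrt (2 * pi) * (\<integral>(x, y). R_fun n x y \<partial>(P \<Otimes>\<^sub>M P))\<bar>
         \<le> ennreal c * (1 + sigma4_sq n P) / (of_nat n)\<^sup>2)"
proof (intro exI[of _ 141] conjI allI impI)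
  fix n :: nat and P :: "(nat \<Rightarrow> real) measure"
  assume n: "n \<ge> 2" and law: "vector_law n P" and int: "integrable P (\<lambda>x. (vnorm n x)\<^sup>2)"
    and mean: "(\<integral>x. (vnorm n x)\<^sup>2 \<partial>P) = real n"
  interpret vector_law_space P n
    using law n by (auto simp: vector_law_def vector_law_space_def vector_law_space_axioms_def)
  let ?f = "\<lambda>x. ((vnorm n x)\<^sup>2 - real n)\<^sup>2"
  have sig: "sigma4_sq n P = (\<integral>\<^sup>+x. ennreal (?f x) \<partial>P) / of_nat n"
    by (simp add: sigma4_sq_def mean)
  have npos: "real n > 0" using n by simp
  let ?L = "\<bar>(\<integral>\<theta>. (omega (proj_cdf n P \<theta>) (typical_cdf n P))\<^sup>2 \<partial>unif_sphere n)
                 - 1 / sqrt (2 * pi) * (\<integral>(x, y). R_fun n x y \<partial>(P \<Otimes>\<^sub>M P))\<bar>"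
  show "ennreal ?L \<le> ennreal 141 * (1 + sigma4_sq n P) / (of_nat n)\<^sup>2"
  proof (cases "(\<integral>\<^sup>+x. ennreal (?f x) \<partial>P) = \<infinity>")
    case True
    then have "ennreal 141 * (1 + sigma4_sq n P) / (of_nat n)\<^sup>2 = \<top>"
      unfolding sig by (simp add: ennreal_top_divide ennreal_mult_top ennreal_of_nat_eq_real_of_nat ennreal_power)
    then show ?thesis by simp
  next
    case False
    have int4: "integrable P ?f"
      using False by (intro integrableI_nonneg) (auto simp: less_top)
    have "(\<integral>\<^sup>+x. ennreal (?f x) \<partial>P) = ennreal (expectation ?f)"
      using int4 by (intro nn_integral_eq_integral) auto
    define A where "A = expectation ?f / n"
    have "A \<ge> 0" by (simp add: A_def)
    have "sigma4_sq n P = ennreal A"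
      using npos \<open>(\<integral>\<^sup>+x. ennreal (?f x) \<partial>P) = ennreal (expectation ?f)\<close> unfolding sig A_def
      by (simp add: ennreal_of_nat_eq_real_of_nat divide_ennreal)
    then have "1 + sigma4_sq n P = ennreal (1 + A)" using \<open>A \<ge> 0\<close> by simp
    moreover have "(of_nat n :: ennreal)\<^sup>2 = ennreal ((real n)\<^sup>2)"
      by (simp add: ennreal_of_nat_eq_real_of_nat ennreal_power)
    ultimately have "ennreal 141 * (1 + sigma4_sq n P) / (of_nat n)\<^sup>2 = ennreal (141 * (1 + A) / (real n)\<^sup>2)"
      using npos \<open>A \<ge> 0\<close> by (simp only: ennreal_mult[symmetric] divide_ennreal zero_less_power mult_nonneg_nonneg
        add_nonneg_nonneg zero_le_one zero_le_numeral)
    then show ?thesis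
      using mean_omega_sq_approx[OF n int mean int4] by (simp only: A_def ennreal_leI)
  qed
qed simp

end
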